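(* Let $p \ge 2$ be an integer and let $\epsilon > 0$ be a small constant. Any single-pass streaming algorithm that, on every Unique Games instance with alphabet size $p$ on $n$ vertices, outputs a $(p-\epsilon)$-approximation to the optimal value with success probability at least $9/10$ over its internal randomness must use at least $c_{p,\epsilon}\sqrt{n}$ bits of space, for some positive constant $c_{p,\epsilon}$ depending only on $p$ and $\epsilon$. Furthermore, the same space lower bound holds already for the task of distinguishing (with success probability at least $9/10$) instances that are fully satisfiable from instances in which every assignment satisfies at most a $(1/p+\epsilon)$ fraction of the constraints, and this holds even when all constraints are linear, i.e. of the form $x_u + x_v = \alpha_{uv}$ with $\alpha_{uv} \in \mathbb{Z}_p$ (arithmetic modulo $p$).
   Context: A Unique Games instance with alphabet $[p]=\{0,1,\dots,p-1\}$ consists of a (multi)graph $G=(V,E)$ with $|V|=n$ and, for each edge $(u,v)\in E$, a permutation $\pi_{uv}:[p]\to[p]$; the constraint on $(u,v)$ is $\pi_{uv}(x_u)=x_v$. The optimal value is the maximum, over all assignments $x:V\to[p]$, of the number of satisfied constraints. In the single-pass streaming model the constraints arrive one by one in an arbitrary (worst-case) order, the algorithm may use only a limited amount of memory (space) and sees each constraint once. A streaming algorithm gives an $f$-approximation if it outputs a value $T$ with $\mathrm{OPT}/f \le T \le \mathrm{OPT}$, where $\mathrm{OPT}$ is the optimal value. No computational restriction is placed on the algorithm besides space. *)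

theory Defs
  imports "HOL-Probability.Probability" "HOL-Combinatorics.Permutations" "HOL-Number_Theory.Cong"
begin

section \<open>Unique Games\<close>

text \<open>
  The vertex set is \<open>{..<n}\<close> and the alphabet is \<open>{..<p}\<close>. A triple \<open>(u, v, \<pi>)\<close> is the edge
  \<open>(u, v)\<close> with the constraint \<open>\<pi> (x u) = x v\<close>. An instance is the list of its constraints in
  order of arrival; repetitions are allowed, so the graph is a multigraph.
\<close>

type_synonym ug_constraint = "nat \<times> nat \<times> (nat \<Rightarrow> nat)"

definition ug_constraints :: "nat \<Rightarrow> nat \<Rightarrow> ug_constraint set" where
  "ug_constraints p n = {(u, v, \<pi>). u < n \<and> v < n \<and> u \<noteq> v \<and> \<pi> permutes {..<p}}"

definition ug_instances :: "nat \<Rightarrow> nat \<Rightarrow> ug_constraint list set" where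
  "ug_instances p n = lists (ug_constraints p n)"

text \<open>The constraints of the form \<open>x u + x v = \<alpha>\<close> in the integers modulo \<open>p\<close>.\<close>

definition linear_constraints :: "nat \<Rightarrow> nat \<Rightarrow> ug_constraint set" where
  "linear_constraints p n =
     {(u, v, \<pi>) \<in> ug_constraints p n.
        \<exists>\<alpha><p. \<forall>a<p. \<forall>b<p. \<pi> a = b \<longleftrightarrow> [a + b = \<alpha>] (mod p)}"

definition linear_instances :: "nat \<Rightarrow> nat \<Rightarrow> ug_constraint list set" where
  "linear_instances p n = lists (linear_constraints p n)"

definition assignments :: "nat \<Rightarrow> nat \<Rightarrow> (nat \<Rightarrow> nat) set" where
  "assignments p n = {..<n} \<rightarrow>\<^sub>E {..<p}"

definition satisfies :: "(nat \<Rightarrow> nat) \<Rightarrow> ug_constraint \<Rightarrow> bool" where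
  "satisfies x = (\<lambda>(u, v, \<pi>). \<pi> (x u) = x v)"

definition num_satisfied :: "(nat \<Rightarrow> nat) \<Rightarrow> ug_constraint list \<Rightarrow> nat" where
  "num_satisfied x I = length (filter (satisfies x) I)"

definition opt_value :: "nat \<Rightarrow> nat \<Rightarrow> ug_constraint list \<Rightarrow> nat" where
  "opt_value p n I = Max ((\<lambda>x. num_satisfied x I) ` assignments p n)"

definition fully_satisfiable :: "nat \<Rightarrow> nat \<Rightarrow> ug_constraint list \<Rightarrow> bool" where
  "fully_satisfiable p n I \<longleftrightarrow> (\<exists>x\<in>assignments p n. num_satisfied x I = length I)"

definition satisfiable_at_most :: "nat \<Rightarrow> nat \<Rightarrow> real \<Rightarrow> ug_constraint list \<Rightarrow> bool" where
  "satisfiable_at_most p n \<gamma> I \<longleftrightarrow>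
     (\<forall>x\<in>assignments p n. real (num_satisfied x I) \<le> \<gamma> * real (length I))"


section \<open>Single-pass streaming algorithms\<close>

text \<open>
  An algorithm has an infinite read-only tape of independent fair coin tosses. Between two
  arrivals it keeps nothing but its memory, a bit string of length \<open>S\<close>. Neither the tape nor the
  position in the stream (the \<open>nat\<close> argument of \<open>alg_step\<close> and \<open>alg_out\<close>) is charged to the space,
  so that a lower bound in this model applies a fortiori when they are. The free position matters:
  multigraphs on \<open>n\<close> vertices have arbitrarily large optimal values, so without it no finite
  memory would suffice even for the trivial \<open>p\<close>-approximation that outputs \<open>m / p\<close> on \<open>m\<close>
  constraints.
\<close>

type_synonym tape = "nat \<Rightarrow> bool"

definition coin_tape :: "tape measure" where
  "coin_tape = Pi\<^sub>M UNIV (\<lambda>_. measure_pmf (bernoulli_pmf (1/2)))"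

record 'o streaming_alg =
  alg_init :: "tape \<Rightarrow> bool list"
  alg_step :: "tape \<Rightarrow> nat \<Rightarrow> bool list \<Rightarrow> ug_constraint \<Rightarrow> bool list"
  alg_out  :: "tape \<Rightarrow> nat \<Rightarrow> bool list \<Rightarrow> 'o"

text \<open>
  \<open>A\<close> is a streaming algorithm using \<open>S\<close> bits of space on instances with \<open>n\<close> vertices and alphabet
  size \<open>p\<close>. There is no computability or uniformity requirement; the measurability conditions
  only ensure that its success probabilities are defined.
\<close>

definition streaming_algorithm ::
    "nat \<Rightarrow> nat \<Rightarrow> nat \<Rightarrow> 'o measure \<Rightarrow> 'o streaming_alg \<Rightarrow> bool" where
  "streaming_algorithm p n S N A \<longleftrightarrow>
     (\<forall>\<omega>. length (alg_init A \<omega>) = S) \<and>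
     (\<forall>\<omega> t s. \<forall>e\<in>ug_constraints p n. length s = S \<longrightarrow> length (alg_step A \<omega> t s e) = S) \<and>
     alg_init A \<in> coin_tape \<rightarrow>\<^sub>M count_space UNIV \<and>
     (\<forall>t s. \<forall>e\<in>ug_constraints p n. length s = S \<longrightarrow>
        (\<lambda>\<omega>. alg_step A \<omega> t s e) \<in> coin_tape \<rightarrow>\<^sub>M count_space UNIV) \<and>
     (\<forall>t s. length s = S \<longrightarrow> (\<lambda>\<omega>. alg_out A \<omega> t s) \<in> coin_tape \<rightarrow>\<^sub>M N)"

fun run_from ::
    "'o streaming_alg \<Rightarrow> tape \<Rightarrow> nat \<Rightarrow> bool list \<Rightarrow> ug_constraint list \<Rightarrow> bool list" where
  "run_from A \<omega> t s [] = s"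
| "run_from A \<omega> t s (e # es) = run_from A \<omega> (Suc t) (alg_step A \<omega> t s e) es"

definition alg_output :: "'o streaming_alg \<Rightarrow> tape \<Rightarrow> ug_constraint list \<Rightarrow> 'o" where
  "alg_output A \<omega> I = alg_out A \<omega> (length I) (run_from A \<omega> 0 (alg_init A \<omega>) I)"

definition success_prob ::
    "'o streaming_alg \<Rightarrow> ug_constraint list \<Rightarrow> ('o \<Rightarrow> bool) \<Rightarrow> real" where
  "success_prob A I Q = measure coin_tape {\<omega> \<in> space coin_tape. Q (alg_output A \<omega> I)}"

definition approximates_opt :: "nat \<Rightarrow> nat \<Rightarrow> real \<Rightarrow> real streaming_alg \<Rightarrow> bool" where
  "approximates_opt p n f A \<longleftrightarrow>
     (\<forall>I\<in>ug_instances p n.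
        success_prob A I
          (\<lambda>T. real (opt_value p n I) / f \<le> T \<and> T \<le> real (opt_value p n I)) \<ge> 9/10)"

text \<open>
  The output \<open>True\<close> stands for ``fully satisfiable''. The instance without constraints is both
  fully satisfiable and satisfiable at most to any fraction, so it has to be left out: it would
  make the task impossible for every algorithm.
\<close>

definition distinguishes ::
    "nat \<Rightarrow> nat \<Rightarrow> real \<Rightarrow> ug_constraint list set \<Rightarrow> bool streaming_alg \<Rightarrow> bool" where
  "distinguishes p n \<gamma> \<I> A \<longleftrightarrow>
     (\<forall>I\<in>\<I>. I \<noteq> [] \<longrightarrow>
        (fully_satisfiable p n I \<longrightarrow> success_prob A I (\<lambda>b. b) \<ge> 9/10) \<and>
        (satisfiable_at_most p n \<gamma> I \<longrightarrow> success_prob A I (\<lambda>b. \<not> b) \<ge> 9/10))"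

end

theory Submission imports Defs begin

text \<open>
  Hidden \<open>x, y \<in> [p]\<^sup>N\<close> with \<open>N = n div 2\<close>. The stream consists of \<open>m = K N\<close> independent uniform edges
  \<open>(u, v)\<close> of the complete bipartite graph, labelled by \<open>x u + y v\<close> (fully satisfiable) or by
  independent uniform labels (for \<open>K\<close> large, by Chernoff and a union bound, almost always satisfiable
  only to a fraction \<open>1/p + \<epsilon>\<close>). Let \<open>D t\<close> be the relative entropy of the memory contents after \<open>t\<close>
  constraints in the first case with respect to the second. By the chain rule and data processing,
  \<open>D (t + 1) - D t\<close> is at most the expected relative entropy, with respect to the uniform
  distribution, of the next label given the memory and the next edge.

  If the posterior density of the hidden pair given the memory is at most \<open>1/\<mu>\<close>, the posterior biases of
  all \<open>N\<^sup>2\<close> labels have squares summing to \<open>O((1 + ln (1/\<mu>))\<^sup>2)\<close> (a level-two inequality, from an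
  exponential moment bound for bilinear forms). As \<open>S\<close> bits of memory typically have
  \<open>ln (1/\<mu>) = O(S)\<close>, a random edge contributes \<open>O((S + 1)\<^sup>2 / N\<^sup>2)\<close>, so \<open>D m = O(K (S + 1)\<^sup>2 / N)\<close>,
  while a successful algorithm forces \<open>D m\<close> above a positive constant. Adding up divergences
  instead of total variation distances is what makes \<open>\<Theta>(N)\<close> steps affordable.
\<close>

section \<open>Exponential moments and the level-two inequality\<close>

text \<open>Hoeffding's lemma for the uniform distribution on \<open>B\<close>. The range
  \<open>[-1, 1]\<close> has length 2, which gives the exponent \<open>s\<^sup>2 * 4 / 8\<close>.
  Negative \<open>s\<close> is reduced to positive \<open>s\<close> by negating
  \<open>\<phi>\<close>.\<close>

lemma sum_exp_mean_zero_le: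
  fixes \<phi> :: "'a \<Rightarrow> real"
  assumes "finite B" "B \<noteq> {}" "(\<Sum>b\<in>B. \<phi> b) = 0" "\<And>b. b \<in> B \<Longrightarrow> \<bar>\<phi> b\<bar> \<le> 1"
  shows "(\<Sum>b\<in>B. exp (s * \<phi> b)) \<le> real (card B) * exp (s\<^sup>2 / 2)"
proof -
  have *: "(\<Sum>b\<in>B. exp (s * \<psi> b)) \<le> real (card B) * exp (s\<^sup>2 / 2)"
    if "s > 0" "(\<Sum>b\<in>B. \<psi> b) = 0" "\<And>b. b \<in> B \<Longrightarrow> \<bar>\<psi> b\<bar> \<le> 1" for s and \<psi> :: "'a \<Rightarrow> real"
  proof -
    interpret interval_bounded_random_variable "measure_pmf (pmf_of_set B)" \<psi> "-1" 1
      using assms(1,2) that(3) by unfold_locales (force simp: AE_measure_pmf_iff abs_le_iff)+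
    have "measure_pmf.expectation (pmf_of_set B) \<psi> = 0"
      using assms(1,2) that(2) by (simp add: integral_pmf_of_set)
    moreover have "integrable (measure_pmf (pmf_of_set B)) (\<lambda>x. exp (s * \<psi> x))"
      using assms(1,2) by (intro integrable_measure_pmf_finite) simp
    ultimately
    have "ennreal (measure_pmf.expectation (pmf_of_set B) (\<lambda>x. exp (s * \<psi> x))) \<le> ennreal (exp (s\<^sup>2 * 4 / 8))"
      using Hoeffdings_lemma_nn_integral_0[OF that(1)]
      by (subst nn_integral_eq_integral[symmetric]) (auto simp: that(1))
    hence "(\<Sum>b\<in>B. exp (s * \<psi> b)) / card B \<le> exp (s\<^sup>2 / 2)"
      using assms(1,2) by (simp add: integral_pmf_of_set)
    thus ?thesis using assms(1,2) by (simp add: divide_le_eq card_gt_0_iff mult.commute)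
  qed
  consider "s > 0" | "s = 0" | "s < 0" by linarith
  thus ?thesis
  proof cases
    case 1 thus ?thesis using *[of s \<phi>] assms by simp
  next
    case 2 thus ?thesis by simp
  next
    case 3 thus ?thesis using *[of "-s" "\<lambda>b. - \<phi> b"] assms by (simp add: sum_negf)
  qed
qed

lemma sum_PiE_insert:
  assumes "i \<notin> U"
  shows "(\<Sum>x\<in>PiE (insert i U) T. F x) = (\<Sum>b\<in>T i. \<Sum>x\<in>PiE U T. F (x(i := b)))"
proof -
  have "inj_on (\<lambda>(y, g). g(i := y)) (T i \<times> Pi\<^sub>E U T)"
    using assms by (rule inj_combinator)
  thus ?thesis
    unfolding PiE_insert_eq by (simp add: sum.reindex sum.cartesian_product split_def)
qed

text \<open>
  The induction integrates out one coordinate at a time. This multiplies the factor \<open>\<tau>\<close> in front of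
  the squared norm by at most \<open>1 + 2 \<tau> A\<close>, where \<open>A\<close> is the squared norm of the coefficient vector of
  the coordinate, and \<open>t / (1 - 2 t \<sigma>)\<close> absorbs the product of these factors.
\<close>

lemma sum_exp_square_norm_le:
  fixes \<phi> :: "'b \<Rightarrow> real" and a :: "'i \<Rightarrow> 'j \<Rightarrow> real"
  assumes B: "finite B" "B \<noteq> {}" "(\<Sum>b\<in>B. \<phi> b) = 0" "\<And>b. b \<in> B \<Longrightarrow> \<bar>\<phi> b\<bar> \<le> 1"
    and V: "finite V" and U: "finite U" and t: "0 \<le> t" "2 * t * (\<Sum>u\<in>U. \<Sum>v\<in>V. (a u v)\<^sup>2) < 1"
  shows "(\<Sum>x\<in>U \<rightarrow>\<^sub>E B. exp (t * (\<Sum>v\<in>V. (z v + (\<Sum>u\<in>U. a u v * \<phi> (x u)))\<^sup>2)))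
     \<le> real (card B) ^ card U * exp (t / (1 - 2 * t * (\<Sum>u\<in>U. \<Sum>v\<in>V. (a u v)\<^sup>2)) *
          ((\<Sum>v\<in>V. (z v)\<^sup>2) + (\<Sum>u\<in>U. \<Sum>v\<in>V. (a u v)\<^sup>2)))"
  using U t(2)
proof (induction U arbitrary: z rule: finite_induct)
  case empty
  then show ?case by simp
next
  case (insert i U z)
  define \<sigma> where "\<sigma> = (\<Sum>u\<in>U. \<Sum>v\<in>V. (a u v)\<^sup>2)"
  define A where "A = (\<Sum>v\<in>V. (a i v)\<^sup>2)"
  define Z where "Z = (\<Sum>v\<in>V. (z v)\<^sup>2)"
  define W where "W = (\<Sum>v\<in>V. z v * a i v)"
  have nonneg: "\<sigma> \<ge> 0" "A \<ge> 0" "Z \<ge> 0"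
    by (auto simp: \<sigma>_def A_def Z_def intro!: sum_nonneg)
  have W: "W\<^sup>2 \<le> Z * A"
    unfolding W_def Z_def A_def by (rule Cauchy_Schwarz_ineq_sum)
  have \<sigma>': "(\<Sum>u\<in>insert i U. \<Sum>v\<in>V. (a u v)\<^sup>2) = A + \<sigma>"
    using insert by (simp add: A_def \<sigma>_def)
  have t1: "2 * t * (A + \<sigma>) < 1" using insert.prems \<sigma>' by simp
  have t2: "2 * t * \<sigma> < 1"
    using t1 nonneg t(1) by (smt (verit) mult_left_mono)
  define \<tau> where "\<tau> = t / (1 - 2 * t * \<sigma>)"
  define \<tau>' where "\<tau>' = t / (1 - 2 * t * (A + \<sigma>))"
  have \<tau>0: "\<tau> \<ge> 0" using t t2 by (simp add: \<tau>_def)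
  have \<tau>\<tau>': "\<tau> * (1 + 2 * \<tau> * A) \<le> \<tau>'"
  proof -
    define p where "p = 1 - 2 * t * \<sigma>"
    define q where "q = 2 * t * A"
    have p: "p > 0" "p - q > 0" "q \<ge> 0"
      using t1 t2 t(1) nonneg by (auto simp: p_def q_def algebra_simps)
    have "\<tau> = t / p" by (simp add: \<tau>_def p_def)
    hence "\<tau> * (1 + 2 * \<tau> * A) = t / p * (1 + q / p)" by (simp add: q_def)
    also have "\<dots> = t * ((p + q) / p\<^sup>2)"
      using p by (simp add: field_simps power2_eq_square)
    \<comment> \<open>Equivalent to \<open>(p + q) * (p - q) \<le> p\<^sup>2\<close>.\<close>
    also have "(p + q) / p\<^sup>2 \<le> 1 / (p - q)"
      using p by (simp add: divide_simps) (simp add: power2_eq_square algebra_simps)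
    hence "t * ((p + q) / p\<^sup>2) \<le> t * (1 / (p - q))"
      using t(1) by (rule mult_left_mono)
    also have "\<dots> = \<tau>'" by (simp add: \<tau>'_def p_def q_def algebra_simps)
    finally show ?thesis .
  qed
  have upd: "(\<Sum>u\<in>U. a u v * \<phi> ((x(i := b)) u)) = (\<Sum>u\<in>U. a u v * \<phi> (x u))" for x v b
    using insert.hyps by (intro sum.cong) auto
  \<comment> \<open>Fixing coordinate \<open>i\<close> to \<open>b\<close> only moves the shift from
    \<open>z v\<close> to \<open>z v + a i v * \<phi> b\<close>; this is why the statement carries
    an arbitrary \<open>z\<close>.\<close>
  have "(\<Sum>x\<in>insert i U \<rightarrow>\<^sub>E B. exp (t * (\<Sum>v\<in>V. (z v + (\<Sum>u\<in>insert i U. a u v * \<phi> (x u)))\<^sup>2)))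
     = (\<Sum>b\<in>B. \<Sum>x\<in>U \<rightarrow>\<^sub>E B. exp (t * (\<Sum>v\<in>V. ((z v + a i v * \<phi> b) + (\<Sum>u\<in>U. a u v * \<phi> (x u)))\<^sup>2)))"
    using insert.hyps
    by (subst sum_PiE_insert) (simp_all add: upd add.assoc del: fun_upd_apply add: fun_upd_same)
  also have "\<dots> \<le> (\<Sum>b\<in>B. real (card B) ^ card U * exp (\<tau> * ((\<Sum>v\<in>V. (z v + a i v * \<phi> b)\<^sup>2) + \<sigma>)))"
    unfolding \<tau>_def \<sigma>_def using t2 \<sigma>_def by (intro sum_mono insert.IH) auto
  also have "\<dots> \<le> (\<Sum>b\<in>B. real (card B) ^ card U * (exp (\<tau> * (Z + A + \<sigma>)) * exp ((2 * \<tau> * W) * \<phi> b)))"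
  proof (intro sum_mono mult_left_mono)
    fix b assume b: "b \<in> B"
    have "(\<Sum>v\<in>V. (z v + a i v * \<phi> b)\<^sup>2) = Z + (\<phi> b)\<^sup>2 * A + 2 * \<phi> b * W"
      unfolding Z_def A_def W_def sum_distrib_left
      by (simp add: sum.distrib[symmetric] power2_eq_square algebra_simps)
    also have "\<dots> \<le> Z + A + 2 * \<phi> b * W"
      using B(4)[OF b] nonneg mult_right_mono[of "(\<phi> b)\<^sup>2" 1 A] by (simp add: abs_square_le_1)
    finally have "\<tau> * ((\<Sum>v\<in>V. (z v + a i v * \<phi> b)\<^sup>2) + \<sigma>) \<le> \<tau> * ((Z + A + 2 * \<phi> b * W) + \<sigma>)"
      using \<tau>0 by (intro mult_left_mono) auto
    thus "exp (\<tau> * ((\<Sum>v\<in>V. (z v + a i v * \<phi> b)\<^sup>2) + \<sigma>)) \<le> exp (\<tau> * (Z + A + \<sigma>)) * exp ((2 * \<tau> * W) * \<phi> b)"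
      unfolding exp_add[symmetric] exp_le_cancel_iff by (simp add: algebra_simps)
  qed simp
  also have "\<dots> = real (card B) ^ card U * exp (\<tau> * (Z + A + \<sigma>)) * (\<Sum>b\<in>B. exp ((2 * \<tau> * W) * \<phi> b))"
    by (simp add: sum_distrib_left mult.assoc)
  \<comment> \<open>The cross term is linear in \<open>\<phi> b\<close>, which has mean zero, so
    averaging over \<open>b\<close> leaves only a term quadratic in \<open>W\<close>. Cauchy-Schwarz
    then bounds \<open>W\<^sup>2\<close> by \<open>Z * A\<close>.\<close>
  also have "\<dots> \<le> real (card B) ^ card U * exp (\<tau> * (Z + A + \<sigma>)) * (real (card B) * exp ((2 * \<tau> * W)\<^sup>2 / 2))"
    by (intro mult_left_mono sum_exp_mean_zero_le B) auto
  also have "\<dots> = real (card B) ^ card (insert i U) * exp (\<tau> * (Z + A + \<sigma>) + 2 * \<tau>\<^sup>2 * W\<^sup>2)"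
    using insert.hyps by (simp add: exp_add power_mult_distrib)
  also have "\<dots> \<le> real (card B) ^ card (insert i U) * exp (\<tau>' * (Z + (A + \<sigma>)))"
  proof -
    have "\<tau> * (Z + A + \<sigma>) + 2 * \<tau>\<^sup>2 * W\<^sup>2 \<le> \<tau> * (Z + A + \<sigma>) + 2 * \<tau>\<^sup>2 * ((Z + A + \<sigma>) * A)"
      using order_trans[OF W mult_right_mono[of Z "Z + A + \<sigma>" A]] nonneg
      by (intro add_left_mono mult_left_mono) auto
    also have "\<dots> = (\<tau> * (1 + 2 * \<tau> * A)) * (Z + A + \<sigma>)"
      by (simp add: algebra_simps power2_eq_square)
    also have "\<dots> \<le> \<tau>' * (Z + A + \<sigma>)"
      using \<tau>\<tau>' nonneg by (intro mult_right_mono) auto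
    finally show ?thesis by (intro mult_left_mono) (auto simp: add.assoc)
  qed
  finally show ?case
    unfolding \<sigma>' \<tau>'_def Z_def .
qed

text \<open>For fixed \<open>x\<close> the exponent is linear in the independent values
  \<open>\<psi> (y v)\<close>. Averaging over \<open>y\<close> first leaves the exponential of a
  squared norm in \<open>x\<close>, to which the preceding bound applies with zero shift.\<close>

lemma sum_exp_bilinear_le:
  fixes \<phi> \<psi> :: "'b \<Rightarrow> real" and a :: "'i \<Rightarrow> 'j \<Rightarrow> real"
  assumes B: "finite B" "B \<noteq> {}"
    and \<phi>: "(\<Sum>b\<in>B. \<phi> b) = 0" "\<And>b. b \<in> B \<Longrightarrow> \<bar>\<phi> b\<bar> \<le> 1"
    and \<psi>: "(\<Sum>b\<in>B. \<psi> b) = 0" "\<And>b. b \<in> B \<Longrightarrow> \<bar>\<psi> b\<bar> \<le> 1"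
    and V: "finite V" and U: "finite U" and a: "(\<Sum>u\<in>U. \<Sum>v\<in>V. (a u v)\<^sup>2) \<le> 1"
  shows "(\<Sum>x\<in>U \<rightarrow>\<^sub>E B. \<Sum>y\<in>V \<rightarrow>\<^sub>E B. exp ((\<Sum>u\<in>U. \<Sum>v\<in>V. a u v * (\<phi> (x u) * \<psi> (y v))) / 2))
     \<le> real (card B) ^ card U * real (card B) ^ card V * exp 1"
proof -
  let ?L = "\<lambda>x v. \<Sum>u\<in>U. a u v * \<phi> (x u)"
  define \<sigma> where "\<sigma> = (\<Sum>u\<in>U. \<Sum>v\<in>V. (a u v)\<^sup>2)"
  have \<sigma>: "0 \<le> \<sigma>" "\<sigma> \<le> 1"
    using a by (auto simp: \<sigma>_def intro!: sum_nonneg)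
  have "(\<Sum>x\<in>U \<rightarrow>\<^sub>E B. \<Sum>y\<in>V \<rightarrow>\<^sub>E B. exp ((\<Sum>u\<in>U. \<Sum>v\<in>V. a u v * (\<phi> (x u) * \<psi> (y v))) / 2))
     = (\<Sum>x\<in>U \<rightarrow>\<^sub>E B. \<Sum>y\<in>V \<rightarrow>\<^sub>E B. \<Prod>v\<in>V. exp ((?L x v / 2) * \<psi> (y v)))"
    unfolding exp_sum[OF V, symmetric]
    by (intro sum.cong refl arg_cong[of _ _ exp])
      (simp add: sum_divide_distrib sum_distrib_right sum.swap[of _ U V] mult.assoc)
  also have "\<dots> = (\<Sum>x\<in>U \<rightarrow>\<^sub>E B. \<Prod>v\<in>V. \<Sum>b\<in>B. exp ((?L x v / 2) * \<psi> b))"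
    using B V by (intro sum.cong refl prod_sum_PiE[symmetric]) auto
  also have "\<dots> \<le> (\<Sum>x\<in>U \<rightarrow>\<^sub>E B. \<Prod>v\<in>V. real (card B) * exp ((?L x v / 2)\<^sup>2 / 2))"
    by (intro sum_mono prod_mono conjI sum_exp_mean_zero_le B \<psi> sum_nonneg) auto
  \<comment> \<open>The factor \<open>1/8\<close> is \<open>(1/2)\<^sup>2 / 2\<close>, from
    Hoeffding's lemma at \<open>?L x v / 2\<close>.\<close>
  also have "\<dots> = real (card B) ^ card V * (\<Sum>x\<in>U \<rightarrow>\<^sub>E B. exp (1/8 * (\<Sum>v\<in>V. (0 + ?L x v)\<^sup>2)))"
    unfolding sum_distrib_left[of "1/8"] exp_sum[OF V]
    by (simp add: prod.distrib power_divide sum_distrib_left)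
  also have "\<dots> \<le> real (card B) ^ card V * (real (card B) ^ card U *
       exp (1/8 / (1 - 2 * (1/8) * (\<Sum>u\<in>U. \<Sum>v\<in>V. (a u v)\<^sup>2)) * ((\<Sum>v\<in>V. 0\<^sup>2) + (\<Sum>u\<in>U. \<Sum>v\<in>V. (a u v)\<^sup>2))))"
    using a by (intro mult_left_mono sum_exp_square_norm_le B \<phi> U V) auto
  \<comment> \<open>As \<open>\<sigma> \<le> 1\<close>, the exponent is at most
    \<open>(1/8) / (3/4) = 1/6\<close>; \<open>exp 1\<close> is a convenient weaker bound.\<close>
  also have "\<dots> \<le> real (card B) ^ card V * (real (card B) ^ card U * exp 1)"
    unfolding \<sigma>_def[symmetric] using \<sigma>
    by (intro mult_left_mono) (auto simp: divide_simps)
  finally show ?thesis by (simp add: mult_ac)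
qed

text \<open>Jensen's inequality for \<open>exp\<close>, without normalising the weights: the tangent
  at the weighted mean \<open>c\<close> lies below the graph.\<close>

lemma exp_weighted_mean_le:
  fixes g Q :: "'a \<Rightarrow> real"
  assumes "finite H" "\<And>h. h \<in> H \<Longrightarrow> 0 \<le> g h" "(\<Sum>h\<in>H. g h) > 0"
  shows "(\<Sum>h\<in>H. g h) * exp ((\<Sum>h\<in>H. g h * Q h) / (\<Sum>h\<in>H. g h)) \<le> (\<Sum>h\<in>H. g h * exp (Q h))"
proof -
  define G where "G = (\<Sum>h\<in>H. g h)"
  define c where "c = (\<Sum>h\<in>H. g h * Q h) / G"
  have "G * exp c = exp c * (G + (\<Sum>h\<in>H. g h * Q h) - c * G)"
    using assms(3) by (simp add: c_def G_def)
  also have "\<dots> = (\<Sum>h\<in>H. g h * (exp c * (1 + (Q h - c))))"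
    by (simp add: G_def sum_distrib_left sum_distrib_right sum.distrib sum_subtractf algebra_simps)
  also have "\<dots> \<le> (\<Sum>h\<in>H. g h * exp (Q h))"
  proof (intro sum_mono mult_left_mono assms)
    fix h
    have "exp c * (1 + (Q h - c)) \<le> exp c * exp (Q h - c)"
      using exp_ge_add_one_self[of "Q h - c"] by (intro mult_left_mono) auto
    thus "exp c * (1 + (Q h - c)) \<le> exp (Q h)" by (simp flip: exp_add)
  qed
  finally show ?thesis by (simp add: c_def G_def)
qed

text \<open>Duality: let \<open>w\<close> be the squared norm of the vector of weighted means.
  Testing against the unit vector in its direction gives a form of mean \<open>sqrt w / 2\<close>.
  Jensen bounds the exponential of this mean by a weighted exponential moment,
  \<open>g \<le> 1\<close> removes the weights, and the moment bound gives
  \<open>\<mu> * exp (sqrt w / 2) \<le> exp 1\<close>.\<close>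

lemma level_two_inequality:
  fixes \<phi> \<psi> :: "'b \<Rightarrow> real" and g :: "('i \<Rightarrow> 'b) \<Rightarrow> ('j \<Rightarrow> 'b) \<Rightarrow> real"
  assumes B: "finite B" "B \<noteq> {}"
    and \<phi>: "(\<Sum>b\<in>B. \<phi> b) = 0" "\<And>b. b \<in> B \<Longrightarrow> \<bar>\<phi> b\<bar> \<le> 1"
    and \<psi>: "(\<Sum>b\<in>B. \<psi> b) = 0" "\<And>b. b \<in> B \<Longrightarrow> \<bar>\<psi> b\<bar> \<le> 1"
    and V: "finite V" and U: "finite U"
    and g: "\<And>x y. 0 \<le> g x y" "\<And>x y. g x y \<le> 1"
    and \<mu>: "(\<Sum>x\<in>U \<rightarrow>\<^sub>E B. \<Sum>y\<in>V \<rightarrow>\<^sub>E B. g x y) = \<mu> * (real (card B) ^ card U * real (card B) ^ card V)"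
       "\<mu> > 0"
  shows "(\<Sum>u\<in>U. \<Sum>v\<in>V. ((\<Sum>x\<in>U \<rightarrow>\<^sub>E B. \<Sum>y\<in>V \<rightarrow>\<^sub>E B. g x y * (\<phi> (x u) * \<psi> (y v)))
             / (\<Sum>x\<in>U \<rightarrow>\<^sub>E B. \<Sum>y\<in>V \<rightarrow>\<^sub>E B. g x y))\<^sup>2) \<le> 4 * (1 + ln (1 / \<mu>))\<^sup>2"
proof -
  define H where "H = (U \<rightarrow>\<^sub>E B) \<times> (V \<rightarrow>\<^sub>E B)"
  have H: "finite H" using U V B by (auto simp: H_def intro!: finite_PiE)
  define K where "K = real (card B) ^ card U * real (card B) ^ card V"
  have K: "K > 0" using B by (auto simp: K_def card_gt_0_iff)
  define G where "G = (\<Sum>h\<in>H. case_prod g h)"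
  have G: "G = \<mu> * K" "G > 0" using \<mu> K by (auto simp: G_def H_def K_def sum.cartesian_product)
  define c where "c u v = (\<Sum>h\<in>H. case_prod g h * (\<phi> (fst h u) * \<psi> (snd h v))) / G" for u v
  define w where "w = (\<Sum>u\<in>U. \<Sum>v\<in>V. (c u v)\<^sup>2)"
  have "w \<le> 4 * (1 + ln (1 / \<mu>))\<^sup>2"
  proof (cases "w \<le> 0")
    case True
    thus ?thesis by (smt (verit) zero_le_power2)
  next
    case False
    define a where "a u v = c u v / sqrt w" for u v
    have "(\<Sum>u\<in>U. \<Sum>v\<in>V. (a u v)\<^sup>2) = 1"
      using False by (simp add: a_def power_divide sum_divide_distrib[symmetric] w_def[symmetric])
    hence a: "(\<Sum>u\<in>U. \<Sum>v\<in>V. (a u v)\<^sup>2) \<le> 1" by simp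
    define Q where "Q h = (\<Sum>u\<in>U. \<Sum>v\<in>V. a u v * (\<phi> (fst h u) * \<psi> (snd h v))) / 2" for h
    have cG: "c u v * G = (\<Sum>h\<in>H. case_prod g h * (\<phi> (fst h u) * \<psi> (snd h v)))" for u v
      using G(2) by (simp add: c_def)
    have "(\<Sum>h\<in>H. case_prod g h * Q h) = (\<Sum>u\<in>U. \<Sum>v\<in>V. a u v * (c u v * G)) / 2"
      unfolding Q_def cG sum_divide_distrib sum_distrib_left sum.swap[of _ U H] sum.swap[of _ V H]
      by (simp add: mult_ac split_def)
    also have "\<dots> = G * (w / sqrt w) / 2"
      by (simp add: a_def w_def sum_distrib_left sum_divide_distrib power2_eq_square mult_ac)
    also have "\<dots> = G * (sqrt w / 2)" using False by (simp add: real_div_sqrt)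
    finally have eq: "(\<Sum>h\<in>H. case_prod g h * Q h) / G = sqrt w / 2" using G(2) by simp
    have "\<mu> * K * exp (sqrt w / 2) \<le> (\<Sum>h\<in>H. case_prod g h * exp (Q h))"
      using exp_weighted_mean_le[of H "case_prod g" Q, folded G_def, unfolded eq] G(2) H g
      by (auto simp: G(1)[symmetric])
    also have "\<dots> \<le> (\<Sum>h\<in>H. exp (Q h))"
      using g by (intro sum_mono) (auto simp: mult_le_cancel_right2 split: prod.splits)
    also have "\<dots> \<le> K * exp 1"
      using sum_exp_bilinear_le[OF B \<phi> \<psi> V U a]
      by (simp add: H_def Q_def K_def sum.cartesian_product split_def)
    finally have "\<mu> * exp (sqrt w / 2) \<le> exp 1" using K by simp
    hence "ln (\<mu> * exp (sqrt w / 2)) \<le> ln (exp 1)" using \<mu> by (subst ln_le_cancel_iff) auto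
    hence "sqrt w \<le> 2 * (1 + ln (1 / \<mu>))" using \<mu> by (simp add: ln_mult ln_div)
    hence "(sqrt w)\<^sup>2 \<le> (2 * (1 + ln (1 / \<mu>)))\<^sup>2" using False by (intro power_mono) auto
    thus ?thesis using False by (simp add: power2_eq_square algebra_simps)
  qed
  thus ?thesis
    by (simp add: w_def c_def G_def H_def sum.cartesian_product split_def)
qed

section \<open>Relative entropy\<close>

definition words :: "'a set \<Rightarrow> nat \<Rightarrow> 'a list set" where
  "words C t = {l. set l \<subseteq> C \<and> length l = t}"

lemma finite_words: "finite C \<Longrightarrow> finite (words C t)"
  unfolding words_def by (rule finite_lists_length_eq)

lemma card_words: "finite C \<Longrightarrow> card (words C t) = card C ^ t"
  unfolding words_def by (rule card_lists_length_eq)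

lemma words_0 [simp]: "words C 0 = {[]}"
  by (auto simp: words_def)

text \<open>The new letter goes to the end because the memory is updated by the most recent
  constraint.\<close>

lemma sum_words_Suc:
  "(\<Sum>l\<in>words C (Suc t). F l) = (\<Sum>l\<in>words C t. \<Sum>c\<in>C. F (l @ [c]))"
proof -
  have "bij_betw (\<lambda>(l, c). l @ [c]) (words C t \<times> C) (words C (Suc t))"
    by (rule bij_betw_byWitness[where f' = "\<lambda>l. (butlast l, last l)"])
      (auto simp: words_def dest: in_set_butlastD intro!: subsetD[OF _ last_in_set] append_butlast_last_id)
  from sum.reindex_bij_betw[OF this, of F] show ?thesis
    by (simp add: sum.cartesian_product split_def)
qed

text \<open>The Kullback-Leibler divergence in nats. Where \<open>Q\<close> vanishes and
  \<open>P\<close> does not, division by zero yields a finite term instead of infinity; the lemmas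
  below therefore assume that \<open>P\<close> vanishes wherever \<open>Q\<close> does.\<close>

definition rel_entropy :: "'a set \<Rightarrow> ('a \<Rightarrow> real) \<Rightarrow> ('a \<Rightarrow> real) \<Rightarrow> real" where
  "rel_entropy I P Q = (\<Sum>i\<in>I. P i * ln (P i / Q i))"

text \<open>This is \<open>ln z \<le> z - 1\<close> at \<open>z = c * Q / P\<close>. The parameter
  \<open>c\<close> is a guess for the ratio \<open>P / Q\<close>, with equality when the guess is
  right; different guesses give the log sum inequality and the lower bound from an event.\<close>

lemma mult_ln_ge:
  fixes P Q c :: real
  assumes "P \<ge> 0" "Q \<ge> 0" "Q = 0 \<Longrightarrow> P = 0" "c > 0"
  shows "P * ln (P / Q) \<ge> P * ln c + P - c * Q"
proof (cases "P = 0")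
  case True
  thus ?thesis using assms by simp
next
  case False
  hence pos: "P > 0" "Q > 0" using assms by force+
  have "ln (c * Q / P) \<le> c * Q / P - 1"
    using pos assms by (intro ln_le_minus_one) simp
  hence "P * ln (c * Q / P) \<le> P * (c * Q / P - 1)" using pos by (intro mult_left_mono) auto
  also have "\<dots> = c * Q - P" using pos by (simp add: right_diff_distrib)
  finally show ?thesis using pos assms by (simp add: ln_mult ln_div algebra_simps)
qed

lemma log_sum_inequality:
  fixes P Q :: "'a \<Rightarrow> real"
  assumes "finite I" "\<And>i. i \<in> I \<Longrightarrow> P i \<ge> 0" "\<And>i. i \<in> I \<Longrightarrow> Q i \<ge> 0"
    "\<And>i. i \<in> I \<Longrightarrow> Q i = 0 \<Longrightarrow> P i = 0"
  shows "(\<Sum>i\<in>I. P i) * ln ((\<Sum>i\<in>I. P i) / (\<Sum>i\<in>I. Q i)) \<le> rel_entropy I P Q"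
proof -
  define a where "a = (\<Sum>i\<in>I. P i)"
  define b where "b = (\<Sum>i\<in>I. Q i)"
  show ?thesis
  proof (cases "a = 0")
    case True
    hence "\<And>i. i \<in> I \<Longrightarrow> P i = 0"
      using assms by (simp add: a_def sum_nonneg_eq_0_iff)
    thus ?thesis by (simp add: rel_entropy_def)
  next
    case False
    have ab: "a > 0" "b > 0"
    proof -
      show "a > 0" using False assms sum_nonneg[of I P] by (simp add: a_def less_le)
      have "b \<noteq> 0"
      proof
        assume "b = 0"
        hence "\<And>i. i \<in> I \<Longrightarrow> P i = 0"
          using assms by (simp add: b_def sum_nonneg_eq_0_iff)
        thus False using False by (simp add: a_def)
      qed
      thus "b > 0" using assms sum_nonneg[of I Q] by (simp add: b_def less_le)
    qed
    \<comment> \<open>The guess is the ratio of the totals, for which the linear terms cancel in the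
      sum.\<close>
    have "a * ln (a / b) = a * ln (a / b) + a - a / b * b" using ab by simp
    also have "\<dots> = (\<Sum>i\<in>I. P i * ln (a / b) + P i - a / b * Q i)"
      unfolding sum.distrib sum_subtractf sum_distrib_left[symmetric] sum_distrib_right[symmetric]
        a_def[symmetric] b_def[symmetric] ..
    also have "\<dots> \<le> rel_entropy I P Q"
      unfolding rel_entropy_def using assms ab by (intro sum_mono mult_ln_ge) auto
    finally show ?thesis by (simp add: a_def b_def)
  qed
qed

text \<open>Data processing for a deterministic map: the log sum inequality on each fibre of
  \<open>f\<close>.\<close>

lemma rel_entropy_image_le:
  fixes P Q :: "'a \<Rightarrow> real"
  assumes "finite I" "finite J" "f ` I \<subseteq> J"
    "\<And>i. i \<in> I \<Longrightarrow> P i \<ge> 0" "\<And>i. i \<in> I \<Longrightarrow> Q i \<ge> 0" "\<And>i. i \<in> I \<Longrightarrow> Q i = 0 \<Longrightarrow> P i = 0"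
  shows "rel_entropy J (\<lambda>j. \<Sum>i | i \<in> I \<and> f i = j. P i) (\<lambda>j. \<Sum>i | i \<in> I \<and> f i = j. Q i)
    \<le> rel_entropy I P Q"
proof -
  have "rel_entropy J (\<lambda>j. \<Sum>i | i \<in> I \<and> f i = j. P i) (\<lambda>j. \<Sum>i | i \<in> I \<and> f i = j. Q i)
    \<le> (\<Sum>j\<in>J. rel_entropy {i \<in> I. f i = j} P Q)"
    unfolding rel_entropy_def[of J] using assms by (intro sum_mono log_sum_inequality) auto
  also have "\<dots> = rel_entropy I P Q"
    unfolding rel_entropy_def using assms by (intro sum.group) auto
  finally show ?thesis .
qed

text \<open>Guessing the density ratio as \<open>2\<close> on \<open>T\<close> and
  \<open>1/2\<close> off \<open>T\<close> gives a bound linear in both masses of \<open>T\<close>.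
  It is used to show that a good distinguishing test forces the entropy up.\<close>

lemma rel_entropy_ge_event:
  fixes P Q :: "'a \<Rightarrow> real"
  assumes "finite I" "T \<subseteq> I" "\<And>i. i \<in> I \<Longrightarrow> P i \<ge> 0" "\<And>i. i \<in> I \<Longrightarrow> Q i \<ge> 0"
    "\<And>i. i \<in> I \<Longrightarrow> Q i = 0 \<Longrightarrow> P i = 0" "(\<Sum>i\<in>I. P i) = 1" "(\<Sum>i\<in>I. Q i) = 1"
  shows "rel_entropy I P Q \<ge> 1/2 + ln 2 * (2 * (\<Sum>i\<in>T. P i) - 1) - 3/2 * (\<Sum>i\<in>T. Q i)"
proof -
  define c :: "'a \<Rightarrow> real" where "c i = (if i \<in> T then 2 else 1/2)" for i
  have split: "(\<Sum>i\<in>I. f i) = (\<Sum>i\<in>T. f i) + (\<Sum>i\<in>I - T. f i)" for f :: "'a \<Rightarrow> real"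
    using assms(1,2) by (metis add.commute sum.subset_diff)
  have "rel_entropy I P Q \<ge> (\<Sum>i\<in>I. P i * ln (c i) + P i - c i * Q i)"
    unfolding rel_entropy_def using assms by (intro sum_mono mult_ln_ge) (auto simp: c_def)
  also have "(\<Sum>i\<in>I. P i * ln (c i) + P i - c i * Q i) =
     (ln 2 + 1) * (\<Sum>i\<in>T. P i) - 2 * (\<Sum>i\<in>T. Q i) + ((1 - ln 2) * (\<Sum>i\<in>I - T. P i) - 1/2 * (\<Sum>i\<in>I - T. Q i))"
    unfolding split sum_distrib_left sum_subtractf[symmetric]
    by (intro arg_cong2[of _ _ _ _ "(+)"] sum.cong) (auto simp: c_def ln_div algebra_simps)
  also have "(\<Sum>i\<in>I - T. P i) = 1 - (\<Sum>i\<in>T. P i)" using split[of P] assms by simp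
  also have "(\<Sum>i\<in>I - T. Q i) = 1 - (\<Sum>i\<in>T. Q i)" using split[of Q] assms by simp
  finally show ?thesis by (simp add: field_simps)
qed

text \<open>Atoms with \<open>1 + ln (1 / \<mu> s) \<le> 3 * L\<close> contribute at most
  \<open>9 * L\<^sup>2 * \<mu> s\<close> each, hence at most \<open>9 * L\<^sup>2\<close> together.
  A lighter atom contributes at most \<open>8 * exp (- real S)\<close>, and there are at most
  \<open>2 ^ S\<close> atoms, so these add at most \<open>8\<close>.\<close>

lemma sum_mult_log_square_le:
  fixes \<mu> :: "'s \<Rightarrow> real"
  assumes "finite \<Sigma>" "card \<Sigma> \<le> 2 ^ S" "\<And>s. s \<in> \<Sigma> \<Longrightarrow> \<mu> s \<ge> 0" "(\<Sum>s\<in>\<Sigma>. \<mu> s) = 1"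
  shows "(\<Sum>s\<in>\<Sigma>. \<mu> s * (1 + ln (1 / \<mu> s))\<^sup>2) \<le> 17 * (real S + 1)\<^sup>2"
proof -
  define L where "L = real S + 1"
  have L: "L \<ge> 1" by (simp add: L_def)
  have "(\<Sum>s\<in>\<Sigma>. \<mu> s * (1 + ln (1 / \<mu> s))\<^sup>2) \<le> (\<Sum>s\<in>\<Sigma>. 9 * L\<^sup>2 * \<mu> s + 8 * exp (- real S))"
  proof (intro sum_mono)
    fix s assume s: "s \<in> \<Sigma>"
    show "\<mu> s * (1 + ln (1 / \<mu> s))\<^sup>2 \<le> 9 * L\<^sup>2 * \<mu> s + 8 * exp (- real S)"
    proof (cases "\<mu> s = 0")
      case False
      hence pos: "\<mu> s > 0" using assms(3)[OF s] by simp
      have "\<mu> s \<le> 1"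
        using member_le_sum[OF s, of \<mu>] assms by simp
      define z where "z = 1 + ln (1 / \<mu> s)"
      have z: "z \<ge> 1" using \<open>\<mu> s \<le> 1\<close> pos by (simp add: z_def)
      have \<mu>: "\<mu> s = exp (1 - z)" using pos by (simp add: z_def ln_div)
      show ?thesis
      proof (cases "z \<le> 3 * L")
        case True
        hence "z\<^sup>2 \<le> (3 * L)\<^sup>2" using z by (intro power_mono) auto
        hence "\<mu> s * z\<^sup>2 \<le> \<mu> s * (9 * L\<^sup>2)" using pos by (intro mult_left_mono) (auto simp: power_mult_distrib)
        thus ?thesis unfolding z_def[symmetric] by (simp add: mult_ac add_increasing2)
      next
        case False
        have "(z/2)\<^sup>2 / 2 \<le> exp (z/2)"
          using exp_lower_Taylor_quadratic[of "z/2"] z by (simp add: add_increasing)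
        hence z2: "z\<^sup>2 \<le> 8 * exp (z/2)" by (simp add: power_divide)
        have "\<mu> s * z\<^sup>2 \<le> exp (1 - z) * (8 * exp (z/2))"
          unfolding \<mu> using z2 by (intro mult_left_mono) auto
        also have "\<dots> = 8 * exp (1 - z/2)" by (simp add: exp_add[symmetric])
        \<comment> \<open>\<open>z > 3 * (real S + 1)\<close> gives
          \<open>1 - z / 2 \<le> - real S\<close>.\<close>
        also have "\<dots> \<le> 8 * exp (- real S)" using False by (simp add: L_def)
        finally show ?thesis
          unfolding z_def[symmetric] using pos by (simp add: add_increasing)
      qed
    qed simp
  qed
  also have "\<dots> = 9 * L\<^sup>2 + 8 * (real (card \<Sigma>) * exp (- real S))"
    using assms(4) by (simp add: sum.distrib sum_distrib_left[symmetric])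
  also have "real (card \<Sigma>) * exp (- real S) \<le> exp (real S) * exp (- real S)"
  proof (intro mult_right_mono)
    have "real (card \<Sigma>) \<le> real (2 ^ S)" using assms(2) by (simp only: of_nat_le_iff)
    also have "\<dots> = 2 ^ S" by simp
    also have "\<dots> \<le> exp 1 ^ S" using exp_ge_add_one_self[of 1] by (intro power_mono) auto
    finally show "real (card \<Sigma>) \<le> exp (real S)" by (simp add: exp_of_nat_mult[symmetric])
  qed simp
  also have "exp (real S) * exp (- real S) = 1" by (simp add: exp_minus)
  finally have "(\<Sum>s\<in>\<Sigma>. \<mu> s * (1 + ln (1 / \<mu> s))\<^sup>2) \<le> 9 * L\<^sup>2 + 8" by simp
  moreover have "1 \<le> L\<^sup>2" using L by (simp add: one_le_power)
  ultimately show ?thesis unfolding L_def by linarith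
qed

section \<open>Streams labelled by a hidden object\<close>

text \<open>A fixed tape turns the algorithm into a deterministic automaton: \<open>\<rho>\<close>
  maps a stream of labelled edges to the memory reached, and \<open>F t\<close> is the transition
  after \<open>t\<close> constraints. \<open>H\<close> holds the hidden objects, from which
  \<open>lab\<close> reads off the label of an edge.\<close>

locale hidden_labelling =
  fixes H :: "'h set" and E :: "'e set" and L :: "'l set" and lab :: "'h \<Rightarrow> 'e \<Rightarrow> 'l"
    and \<Sigma> :: "'s set" and \<rho> :: "('e \<times> 'l) list \<Rightarrow> 's" and F :: "nat \<Rightarrow> 's \<Rightarrow> 'e \<times> 'l \<Rightarrow> 's"
  assumes finite: "finite H" "finite E" "finite L" "finite \<Sigma>"
    and nonempty: "H \<noteq> {}" "E \<noteq> {}" "L \<noteq> {}"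
    and lab: "h \<in> H \<Longrightarrow> e \<in> E \<Longrightarrow> lab h e \<in> L"
    and F: "s \<in> \<Sigma> \<Longrightarrow> c \<in> E \<times> L \<Longrightarrow> F t s c \<in> \<Sigma>"
    and \<rho>: "set l \<subseteq> E \<times> L \<Longrightarrow> \<rho> l \<in> \<Sigma>"
    and \<rho>_snoc: "set l \<subseteq> E \<times> L \<Longrightarrow> c \<in> E \<times> L \<Longrightarrow> \<rho> (l @ [c]) = F (length l) (\<rho> l) c"
begin

lemma card_pos: "real (card H) > 0" "real (card E) > 0" "real (card L) > 0"
  using finite nonempty by (auto simp: card_gt_0_iff)

definition planted :: "'h \<Rightarrow> 'e list \<Rightarrow> ('e \<times> 'l) list" where
  "planted h = map (\<lambda>e. (e, lab h e))"

text \<open>The probability of memory \<open>s\<close> given the hidden object \<open>h\<close>,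
  under \<open>t\<close> uniform edges. As a function of \<open>h\<close> it is a likelihood with
  values in \<open>[0, 1]\<close>, that is, an unnormalised posterior; \<open>yes t s\<close> is its
  mean.\<close>

definition hit :: "nat \<Rightarrow> 'h \<Rightarrow> 's \<Rightarrow> real" where
  "hit t h s = (\<Sum>l\<in>words E t. of_bool (\<rho> (planted h l) = s)) / real (card E) ^ t"

definition yes :: "nat \<Rightarrow> 's \<Rightarrow> real" where
  "yes t s = (\<Sum>h\<in>H. hit t h s) / real (card H)"

definition no :: "nat \<Rightarrow> 's \<Rightarrow> real" where
  "no t s = (\<Sum>l\<in>words (E \<times> L) t. of_bool (\<rho> l = s)) / (real (card E) * real (card L)) ^ t"

lemma planted_words: "h \<in> H \<Longrightarrow> l \<in> words E t \<Longrightarrow> planted h l \<in> words (E \<times> L) t"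
  using lab by (auto simp: words_def planted_def)

lemma hit_nonneg: "hit t h s \<ge> 0"
  by (simp add: hit_def sum_nonneg)

lemma hit_le_1: "hit t h s \<le> 1"
proof -
  have "(\<Sum>l\<in>words E t. of_bool (\<rho> (planted h l) = s)) \<le> (\<Sum>l\<in>words E t. 1::real)"
    by (intro sum_mono) auto
  thus ?thesis using card_pos finite by (simp add: hit_def card_words divide_le_eq)
qed

lemma yes_nonneg: "yes t s \<ge> 0"
  by (simp add: yes_def sum_nonneg hit_nonneg)

lemma no_nonneg: "no t s \<ge> 0"
  by (simp add: no_def sum_nonneg)

lemma sum_of_bool_state:
  assumes "x \<in> \<Sigma>"
  shows "(\<Sum>s\<in>\<Sigma>. of_bool (x = s) * f s) = (f x :: real)"
  using assms finite by (simp add: of_bool_def if_distrib[of "\<lambda>c. c * _"] cong: if_cong)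

lemma sum_hit: "h \<in> H \<Longrightarrow> (\<Sum>s\<in>\<Sigma>. hit t h s * f s) = (\<Sum>l\<in>words E t. f (\<rho> (planted h l))) / real (card E) ^ t"
proof -
  assume h: "h \<in> H"
  have "(\<Sum>s\<in>\<Sigma>. hit t h s * f s) = (\<Sum>l\<in>words E t. \<Sum>s\<in>\<Sigma>. of_bool (\<rho> (planted h l) = s) * f s) / real (card E) ^ t"
    unfolding hit_def sum_divide_distrib sum_distrib_right sum.swap[of _ \<Sigma>] by (simp add: mult_ac)
  also have "(\<Sum>l\<in>words E t. \<Sum>s\<in>\<Sigma>. of_bool (\<rho> (planted h l) = s) * f s) = (\<Sum>l\<in>words E t. f (\<rho> (planted h l)))"
    using planted_words[OF h] by (intro sum.cong sum_of_bool_state \<rho>) (auto simp: words_def)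
  finally show ?thesis .
qed

lemma sum_no: "(\<Sum>s\<in>\<Sigma>. no t s * f s) = (\<Sum>l\<in>words (E \<times> L) t. f (\<rho> l)) / (real (card E) * real (card L)) ^ t"
proof -
  have "(\<Sum>s\<in>\<Sigma>. no t s * f s) = (\<Sum>l\<in>words (E \<times> L) t. \<Sum>s\<in>\<Sigma>. of_bool (\<rho> l = s) * f s) / (real (card E) * real (card L)) ^ t"
    unfolding no_def sum_divide_distrib sum_distrib_right sum.swap[of _ \<Sigma>] by (simp add: mult_ac)
  also have "(\<Sum>l\<in>words (E \<times> L) t. \<Sum>s\<in>\<Sigma>. of_bool (\<rho> l = s) * f s) = (\<Sum>l\<in>words (E \<times> L) t. f (\<rho> l))"
    by (intro sum.cong sum_of_bool_state \<rho>) (auto simp: words_def)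
  finally show ?thesis .
qed

lemma sum_yes: "(\<Sum>s\<in>\<Sigma>. yes t s * f s)
   = (\<Sum>h\<in>H. \<Sum>l\<in>words E t. f (\<rho> (planted h l))) / (real (card H) * real (card E) ^ t)"
proof -
  have "(\<Sum>s\<in>\<Sigma>. yes t s * f s) = (\<Sum>h\<in>H. \<Sum>s\<in>\<Sigma>. hit t h s * f s) / real (card H)"
    unfolding yes_def sum_divide_distrib sum_distrib_right sum.swap[of _ \<Sigma>] by (simp add: mult_ac)
  also have "(\<Sum>h\<in>H. \<Sum>s\<in>\<Sigma>. hit t h s * f s)
      = (\<Sum>h\<in>H. (\<Sum>l\<in>words E t. f (\<rho> (planted h l))) / real (card E) ^ t)"
    by (intro sum.cong sum_hit) auto
  finally show ?thesis by (simp add: sum_divide_distrib[symmetric] mult.commute)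
qed

lemma sum_yes_1: "(\<Sum>s\<in>\<Sigma>. yes t s) = 1"
  using sum_yes[of t "\<lambda>_. 1"] card_pos finite nonempty by (simp add: card_words)

lemma sum_no_1: "(\<Sum>s\<in>\<Sigma>. no t s) = 1"
  using sum_no[of t "\<lambda>_. 1"] card_pos finite nonempty by (simp add: card_words card_cartesian_product)

text \<open>Absolute continuity: every planted stream also occurs among the streams with arbitrary
  labels.\<close>

lemma no_eq_0D: "no t s = 0 \<Longrightarrow> yes t s = 0"
proof -
  assume "no t s = 0"
  hence "\<rho> l \<noteq> s" if "l \<in> words (E \<times> L) t" for l
    using that card_pos finite by (auto simp: no_def sum_nonneg_eq_0_iff finite_words)
  hence "hit t h s = 0" if "h \<in> H" for h
    using planted_words[OF that] by (simp add: hit_def)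
  thus ?thesis by (simp add: yes_def)
qed

text \<open>\<open>yes3\<close> and \<open>no3\<close> are joint laws of the memory, the next edge
  and its label. The edge is fresh and uniform in both; the label is tied to the memory through
  \<open>h\<close> in the first and uniform in the second.\<close>

definition yes3 :: "nat \<Rightarrow> 's \<times> 'e \<times> 'l \<Rightarrow> real" where
  "yes3 t = (\<lambda>(s, e, \<alpha>). (\<Sum>h\<in>H. hit t h s * of_bool (lab h e = \<alpha>)) / (real (card H) * real (card E)))"

definition no3 :: "nat \<Rightarrow> 's \<times> 'e \<times> 'l \<Rightarrow> real" where
  "no3 t = (\<lambda>(s, e, \<alpha>). no t s / (real (card E) * real (card L)))"

lemma sum_Collect_of_bool:
  "finite A \<Longrightarrow> (\<Sum>i | i \<in> A \<and> P i. f i) = (\<Sum>i\<in>A. f i * of_bool (P i))" for f :: "'x \<Rightarrow> real"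
  unfolding sum.inter_filter[of A f P] by (intro sum.cong) auto

lemma sum_step_eq:
  "(\<Sum>i | i \<in> \<Sigma> \<times> E \<times> L \<and> (\<lambda>(s, c). F t s c) i = s'. f i)
     = (\<Sum>s\<in>\<Sigma>. \<Sum>e\<in>E. \<Sum>\<alpha>\<in>L. f (s, e, \<alpha>) * of_bool (F t s (e, \<alpha>) = s'))"
  for f :: "'s \<times> 'e \<times> 'l \<Rightarrow> real"
proof -
  have "(\<Sum>s\<in>\<Sigma>. \<Sum>e\<in>E. \<Sum>\<alpha>\<in>L. f (s, e, \<alpha>) * of_bool (F t s (e, \<alpha>) = s'))
     = (\<Sum>(s, e, \<alpha>)\<in>\<Sigma> \<times> E \<times> L. f (s, e, \<alpha>) * of_bool (F t s (e, \<alpha>) = s'))"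
    by (simp only: sum.cartesian_product)
  also have "\<dots> = (\<Sum>i\<in>\<Sigma> \<times> E \<times> L. f i * of_bool ((\<lambda>(s, c). F t s c) i = s'))"
    by (intro sum.cong) auto
  finally show ?thesis using finite by (subst sum_Collect_of_bool) auto
qed

lemma yes_Suc:
  "yes (Suc t) s' = (\<Sum>i | i \<in> \<Sigma> \<times> E \<times> L \<and> (\<lambda>(s, c). F t s c) i = s'. yes3 t i)"
proof -
  have "hit (Suc t) h s' = (\<Sum>s\<in>\<Sigma>. hit t h s * (\<Sum>e\<in>E. of_bool (F t s (e, lab h e) = s'))) / real (card E)"
    if h: "h \<in> H" for h
  proof -
    have "(\<Sum>l\<in>words E t. \<Sum>e\<in>E. of_bool (\<rho> (planted h (l @ [e])) = s'))
       = (\<Sum>l\<in>words E t. \<Sum>e\<in>E. of_bool (F t (\<rho> (planted h l)) (e, lab h e) = s') :: real)"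
    proof (intro sum.cong refl)
      fix l e assume "l \<in> words E t" "e \<in> E"
      moreover from this have "set (planted h l) \<subseteq> E \<times> L" "length (planted h l) = t"
        using planted_words[OF h] by (auto simp: words_def)
      ultimately show "of_bool (\<rho> (planted h (l @ [e])) = s') = (of_bool (F t (\<rho> (planted h l)) (e, lab h e) = s') :: real)"
        using \<rho>_snoc[of "planted h l" "(e, lab h e)"] lab[OF h] by (simp add: planted_def)
    qed
    thus ?thesis
      by (simp add: hit_def[of "Suc t"] sum_words_Suc sum_hit[OF h] mult.commute)
  qed
  hence "yes (Suc t) s' = (\<Sum>h\<in>H. \<Sum>s\<in>\<Sigma>. \<Sum>e\<in>E. hit t h s * of_bool (F t s (e, lab h e) = s')) / (real (card H) * real (card E))"
    by (simp add: yes_def sum_divide_distrib[symmetric] sum_distrib_left mult.commute)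
  \<comment> \<open>A sum over all labels is inserted so that the step becomes a map on triples;
    only \<open>\<alpha> = lab h e\<close> contributes.\<close>
  also have "(\<Sum>h\<in>H. \<Sum>s\<in>\<Sigma>. \<Sum>e\<in>E. hit t h s * of_bool (F t s (e, lab h e) = s'))
     = (\<Sum>h\<in>H. \<Sum>s\<in>\<Sigma>. \<Sum>e\<in>E. \<Sum>\<alpha>\<in>L. of_bool (lab h e = \<alpha>) * (hit t h s * of_bool (F t s (e, \<alpha>) = s')))"
    using lab finite
    by (intro sum.cong refl) (simp add: of_bool_def if_distrib[of "\<lambda>c. c * _"] cong: if_cong)
  also have "\<dots> = (\<Sum>s\<in>\<Sigma>. \<Sum>e\<in>E. \<Sum>\<alpha>\<in>L. (\<Sum>h\<in>H. hit t h s * of_bool (lab h e = \<alpha>)) * of_bool (F t s (e, \<alpha>) = s'))"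
    unfolding sum_distrib_right sum.swap[of _ H] by (simp add: mult_ac)
  finally show ?thesis
    unfolding sum_step_eq yes3_def split times_divide_eq_left sum_divide_distrib[symmetric] .
qed

lemma no_Suc:
  "no (Suc t) s' = (\<Sum>i | i \<in> \<Sigma> \<times> E \<times> L \<and> (\<lambda>(s, c). F t s c) i = s'. no3 t i)"
proof -
  have pairs: "(\<Sum>c\<in>E \<times> L. f c) = (\<Sum>e\<in>E. \<Sum>\<alpha>\<in>L. f (e, \<alpha>))" for f :: "'e \<times> 'l \<Rightarrow> real"
    by (simp add: sum.cartesian_product split_def)
  have "(\<Sum>l\<in>words (E \<times> L) t. \<Sum>c\<in>E \<times> L. of_bool (\<rho> (l @ [c]) = s'))
       = (\<Sum>l\<in>words (E \<times> L) t. \<Sum>c\<in>E \<times> L. of_bool (F t (\<rho> l) c = s') :: real)"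
    by (intro sum.cong refl) (auto simp: words_def \<rho>_snoc)
  from this have "no (Suc t) s' = (\<Sum>s\<in>\<Sigma>. no t s * (\<Sum>c\<in>E \<times> L. of_bool (F t s c = s'))) / (real (card E) * real (card L))"
    by (simp add: no_def[of "Suc t"] sum_words_Suc sum_no mult.commute)
  also have "\<dots> = (\<Sum>s\<in>\<Sigma>. \<Sum>e\<in>E. \<Sum>\<alpha>\<in>L. no t s * of_bool (F t s (e, \<alpha>) = s')) / (real (card E) * real (card L))"
    by (simp only: pairs sum_distrib_left)
  finally show ?thesis
    unfolding sum_step_eq no3_def split times_divide_eq_left sum_divide_distrib[symmetric] .
qed

lemma yes3_nonneg: "yes3 t i \<ge> 0"
  by (auto simp: yes3_def hit_nonneg split: prod.splits intro!: divide_nonneg_nonneg sum_nonneg mult_nonneg_nonneg)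

lemma no3_nonneg: "no3 t i \<ge> 0"
  by (auto simp: no3_def no_nonneg split: prod.splits)

lemma yes3_le: "yes3 t (s, e, \<alpha>) \<le> yes t s / real (card E)"
proof -
  have "(\<Sum>h\<in>H. hit t h s * of_bool (lab h e = \<alpha>)) \<le> (\<Sum>h\<in>H. hit t h s)"
    by (intro sum_mono) (auto simp: hit_nonneg)
  thus ?thesis using card_pos by (simp add: yes3_def yes_def divide_simps)
qed

lemma no3_eq_0D: "no3 t i = 0 \<Longrightarrow> yes3 t i = 0"
proof (cases i)
  case (fields s e \<alpha>)
  assume "no3 t i = 0"
  hence "yes t s = 0" using card_pos no_eq_0D by (simp add: fields no3_def)
  thus ?thesis using yes3_le[of t s e \<alpha>] yes3_nonneg[of t i] by (simp add: fields)
qed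

text \<open>The conditional probability of the label given the memory. It is \<open>0\<close> where
  \<open>yes t s = 0\<close>, so normalisation needs \<open>yes t s \<noteq> 0\<close>.\<close>

definition posterior :: "nat \<Rightarrow> 's \<Rightarrow> 'e \<Rightarrow> 'l \<Rightarrow> real" where
  "posterior t s e \<alpha> = (\<Sum>h\<in>H. hit t h s * of_bool (lab h e = \<alpha>)) / (\<Sum>h\<in>H. hit t h s)"

lemma yes3_posterior: "yes3 t (s, e, \<alpha>) = yes t s * posterior t s e \<alpha> / real (card E)"
proof (cases "yes t s = 0")
  case True
  thus ?thesis using yes3_le[of t s e \<alpha>] yes3_nonneg[of t "(s, e, \<alpha>)"] by simp
next
  case False
  thus ?thesis by (simp add: yes3_def yes_def posterior_def)
qed

lemma sum_posterior:
  assumes "yes t s \<noteq> 0" "e \<in> E"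
  shows "(\<Sum>\<alpha>\<in>L. posterior t s e \<alpha>) = 1"
proof -
  have "(\<Sum>\<alpha>\<in>L. \<Sum>h\<in>H. hit t h s * of_bool (lab h e = \<alpha>)) = (\<Sum>h\<in>H. hit t h s)"
    using lab assms(2) finite
    by (subst sum.swap, intro sum.cong refl) (simp add: of_bool_def if_distrib cong: if_cong)
  thus ?thesis using assms by (simp add: posterior_def sum_divide_distrib[symmetric] yes_def)
qed

text \<open>Data processing passes from the next memory to the triple of memory, edge and label,
  whose relative entropy splits by the chain rule. In the conditional part
  \<open>ln z \<le> z - 1\<close> replaces entropy by the chi-square distance of the label from
  uniform.\<close>

lemma rel_entropy_step:
  "rel_entropy \<Sigma> (yes (Suc t)) (no (Suc t)) \<le> rel_entropy \<Sigma> (yes t) (no t) +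
     real (card L) / real (card E) * (\<Sum>s\<in>\<Sigma>. yes t s * (\<Sum>e\<in>E. \<Sum>\<alpha>\<in>L. (posterior t s e \<alpha> - 1 / real (card L))\<^sup>2))"
proof -
  let ?k = "real (card L)" and ?E = "real (card E)"
  have "rel_entropy \<Sigma> (\<lambda>s'. \<Sum>i | i \<in> \<Sigma> \<times> E \<times> L \<and> (\<lambda>(s, c). F t s c) i = s'. yes3 t i)
      (\<lambda>s'. \<Sum>i | i \<in> \<Sigma> \<times> E \<times> L \<and> (\<lambda>(s, c). F t s c) i = s'. no3 t i)
    \<le> rel_entropy (\<Sigma> \<times> E \<times> L) (yes3 t) (no3 t)"
  proof (intro rel_entropy_image_le)
    show "(\<lambda>(s, c). F t s c) ` (\<Sigma> \<times> E \<times> L) \<subseteq> \<Sigma>" using F by auto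
  qed (use finite yes3_nonneg no3_nonneg no3_eq_0D in auto)
  hence "rel_entropy \<Sigma> (yes (Suc t)) (no (Suc t)) \<le> rel_entropy (\<Sigma> \<times> E \<times> L) (yes3 t) (no3 t)"
    by (simp only: yes_Suc[symmetric] no_Suc[symmetric])
  also have "\<dots> = (\<Sum>s\<in>\<Sigma>. \<Sum>e\<in>E. \<Sum>\<alpha>\<in>L. yes3 t (s, e, \<alpha>) * ln (yes3 t (s, e, \<alpha>) / no3 t (s, e, \<alpha>)))"
    unfolding rel_entropy_def sum.cartesian_product by (intro sum.cong) auto
  also have "\<dots> \<le> (\<Sum>s\<in>\<Sigma>. \<Sum>e\<in>E. \<Sum>\<alpha>\<in>L. yes t s * posterior t s e \<alpha> / ?E * ln (yes t s / no t s)
      + yes t s / ?E * (posterior t s e \<alpha> * (?k * posterior t s e \<alpha> - 1)))"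
  proof (intro sum_mono)
    fix s e \<alpha>
    let ?q = "posterior t s e \<alpha>"
    show "yes3 t (s, e, \<alpha>) * ln (yes3 t (s, e, \<alpha>) / no3 t (s, e, \<alpha>))
      \<le> yes t s * ?q / ?E * ln (yes t s / no t s) + yes t s / ?E * (?q * (?k * ?q - 1))"
    proof (cases "yes t s * ?q = 0")
      case True
      thus ?thesis by (auto simp: yes3_posterior)
    next
      case False
      hence "yes t s > 0" "no t s > 0"
        using yes_nonneg[of t s] no_nonneg[of t s] no_eq_0D[of t s] by (auto simp: less_le)
      moreover have "?q \<ge> 0"
        by (auto simp: posterior_def hit_nonneg intro!: divide_nonneg_nonneg sum_nonneg)
      ultimately have pos: "yes t s > 0" "no t s > 0" "?q > 0" using False by (auto simp: less_le)
      have "yes3 t (s, e, \<alpha>) / no3 t (s, e, \<alpha>) = (yes t s / no t s) * (?k * ?q)"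
        using card_pos by (simp add: yes3_posterior no3_def)
      also have "ln \<dots> = ln (yes t s / no t s) + ln (?k * ?q)"
        using pos card_pos by (intro ln_mult_pos) auto
      also have "\<dots> \<le> ln (yes t s / no t s) + (?k * ?q - 1)"
        using pos card_pos by (intro add_left_mono ln_le_minus_one) auto
      finally have "yes t s * ?q / ?E * ln (yes3 t (s, e, \<alpha>) / no3 t (s, e, \<alpha>))
          \<le> yes t s * ?q / ?E * (ln (yes t s / no t s) + (?k * ?q - 1))"
        using pos card_pos by (intro mult_left_mono) auto
      thus ?thesis by (simp add: yes3_posterior distrib_left)
    qed
  qed
  also have "\<dots> = (\<Sum>s\<in>\<Sigma>. yes t s * ln (yes t s / no t s) +
      yes t s / ?E * (\<Sum>e\<in>E. \<Sum>\<alpha>\<in>L. ?k * (posterior t s e \<alpha> - 1 / ?k)\<^sup>2))"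
  proof (intro sum.cong refl)
    fix s
    show "(\<Sum>e\<in>E. \<Sum>\<alpha>\<in>L. yes t s * posterior t s e \<alpha> / ?E * ln (yes t s / no t s)
        + yes t s / ?E * (posterior t s e \<alpha> * (?k * posterior t s e \<alpha> - 1)))
      = yes t s * ln (yes t s / no t s) +
      yes t s / ?E * (\<Sum>e\<in>E. \<Sum>\<alpha>\<in>L. ?k * (posterior t s e \<alpha> - 1 / ?k)\<^sup>2)"
    proof (cases "yes t s = 0")
      case False
      have *: "(\<Sum>\<alpha>\<in>L. posterior t s e \<alpha> * (?k * posterior t s e \<alpha> - 1))
          = (\<Sum>\<alpha>\<in>L. ?k * (posterior t s e \<alpha> - 1 / ?k)\<^sup>2)" if "e \<in> E" for e
      proof -
        \<comment> \<open>The terms of the two sides differ by \<open>1 / ?k\<close> minus the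
          posterior, which sums to zero over the labels.\<close>
        have "(\<Sum>\<alpha>\<in>L. ?k * (posterior t s e \<alpha> - 1 / ?k)\<^sup>2)
          = (\<Sum>\<alpha>\<in>L. posterior t s e \<alpha> * (?k * posterior t s e \<alpha> - 1) - posterior t s e \<alpha> + 1 / ?k)"
        proof (intro sum.cong refl)
          fix \<alpha>
          have "k * (q - 1 / k)\<^sup>2 = q * (k * q - 1) - q + 1 / k" if "k > 0" for q k :: real
            using that by (simp add: power2_eq_square field_simps)
          thus "?k * (posterior t s e \<alpha> - 1 / ?k)\<^sup>2
              = posterior t s e \<alpha> * (?k * posterior t s e \<alpha> - 1) - posterior t s e \<alpha> + 1 / ?k"
            using card_pos by blast
        qed
        thus ?thesis using card_pos sum_posterior[OF False that]
          by (simp add: sum.distrib sum_subtractf)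
      qed
      have "(\<Sum>e\<in>E. \<Sum>\<alpha>\<in>L. posterior t s e \<alpha> * (?k * posterior t s e \<alpha> - 1))
         = (\<Sum>e\<in>E. \<Sum>\<alpha>\<in>L. ?k * (posterior t s e \<alpha> - 1 / ?k)\<^sup>2)"
        by (intro sum.cong refl *)
      moreover have "(\<Sum>e\<in>E. \<Sum>\<alpha>\<in>L. yes t s * posterior t s e \<alpha> / ?E * ln (yes t s / no t s))
         = (\<Sum>e\<in>E. yes t s / ?E * ln (yes t s / no t s) * (\<Sum>\<alpha>\<in>L. posterior t s e \<alpha>))"
        unfolding sum_distrib_left by (intro sum.cong) auto
      moreover have "\<dots> = yes t s * ln (yes t s / no t s)"
        using card_pos sum_posterior[OF False] by simp
      ultimately show ?thesis
        by (simp only: sum.distrib sum_distrib_left[of "yes t s / ?E", symmetric])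
    qed simp
  qed
  also have "\<dots> = rel_entropy \<Sigma> (yes t) (no t) +
     ?k / ?E * (\<Sum>s\<in>\<Sigma>. yes t s * (\<Sum>e\<in>E. \<Sum>\<alpha>\<in>L. (posterior t s e \<alpha> - 1 / ?k)\<^sup>2))"
    unfolding sum.distrib rel_entropy_def sum_distrib_left[of "?k / ?E"]
    by (intro arg_cong2[where f = "(+)"] sum.cong refl) (simp add: sum_distrib_left[symmetric])
  finally show ?thesis .
qed

lemma rel_entropy_0: "rel_entropy \<Sigma> (yes 0) (no 0) = 0"
proof -
  have "yes 0 s = of_bool (\<rho> [] = s)" "no 0 s = of_bool (\<rho> [] = s)" for s
    using card_pos by (simp_all add: yes_def no_def hit_def planted_def)
  thus ?thesis by (auto simp: rel_entropy_def intro!: sum.neutral)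
qed

lemma rel_entropy_singleton:
  assumes "\<Sigma> = {s}"
  shows "rel_entropy \<Sigma> (yes t) (no t) = 0"
proof -
  have "yes t s = 1" "no t s = 1"
    using sum_yes_1[of t] sum_no_1[of t] unfolding assms by simp_all
  thus ?thesis unfolding assms rel_entropy_def by simp
qed

text \<open>\<open>level2\<close> is applied to the likelihood \<open>hit t h s\<close>, whose mean
  over \<open>h\<close> is \<open>yes t s\<close>, so the biases cost
  \<open>(1 + ln (1 / yes t s))\<^sup>2\<close>. Averaged over the memory this is at most
  \<open>17 * (real S + 1)\<^sup>2\<close>, for each of the \<open>t\<close> steps.\<close>

lemma rel_entropy_le:
  assumes \<Sigma>: "card \<Sigma> \<le> 2 ^ S" and B: "B \<ge> 0"
    and level2: "\<And>g. (\<And>h. 0 \<le> g h \<and> g h \<le> 1) \<Longrightarrow> 0 < (\<Sum>h\<in>H. g h) \<Longrightarrow>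
      (\<Sum>e\<in>E. \<Sum>\<alpha>\<in>L. ((\<Sum>h\<in>H. g h * of_bool (lab h e = \<alpha>)) / (\<Sum>h\<in>H. g h) - 1 / real (card L))\<^sup>2)
        \<le> B * (1 + ln (real (card H) / (\<Sum>h\<in>H. g h)))\<^sup>2"
  shows "rel_entropy \<Sigma> (yes t) (no t) \<le> real t * (real (card L) / real (card E) * (B * (17 * (real S + 1)\<^sup>2)))"
proof (induction t)
  case 0
  thus ?case by (simp add: rel_entropy_0)
next
  case (Suc t)
  have "(\<Sum>s\<in>\<Sigma>. yes t s * (\<Sum>e\<in>E. \<Sum>\<alpha>\<in>L. (posterior t s e \<alpha> - 1 / real (card L))\<^sup>2))
     \<le> (\<Sum>s\<in>\<Sigma>. yes t s * (B * (1 + ln (1 / yes t s))\<^sup>2))"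
  proof (intro sum_mono)
    fix s
    show "yes t s * (\<Sum>e\<in>E. \<Sum>\<alpha>\<in>L. (posterior t s e \<alpha> - 1 / real (card L))\<^sup>2)
     \<le> yes t s * (B * (1 + ln (1 / yes t s))\<^sup>2)"
    proof (cases "yes t s = 0")
      case False
      hence "(\<Sum>h\<in>H. hit t h s) \<noteq> 0" by (auto simp: yes_def)
      moreover have "(\<Sum>h\<in>H. hit t h s) \<ge> 0" by (intro sum_nonneg hit_nonneg)
      ultimately have "(\<Sum>h\<in>H. hit t h s) > 0" by linarith
      hence "(\<Sum>e\<in>E. \<Sum>\<alpha>\<in>L. (posterior t s e \<alpha> - 1 / real (card L))\<^sup>2)
        \<le> B * (1 + ln (real (card H) / (\<Sum>h\<in>H. hit t h s)))\<^sup>2"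
        unfolding posterior_def
        using level2[of "\<lambda>h. hit t h s"] hit_nonneg hit_le_1 by blast
      also have "real (card H) / (\<Sum>h\<in>H. hit t h s) = 1 / yes t s"
        by (simp add: yes_def)
      finally show ?thesis by (intro mult_left_mono yes_nonneg)
    qed simp
  qed
  also have "\<dots> = B * (\<Sum>s\<in>\<Sigma>. yes t s * (1 + ln (1 / yes t s))\<^sup>2)"
    by (simp add: sum_distrib_left mult_ac)
  also have "\<dots> \<le> B * (17 * (real S + 1)\<^sup>2)"
    by (intro mult_left_mono sum_mult_log_square_le B \<Sigma> finite sum_yes_1 yes_nonneg)
  finally have "real (card L) / real (card E) * (\<Sum>s\<in>\<Sigma>. yes t s * (\<Sum>e\<in>E. \<Sum>\<alpha>\<in>L. (posterior t s e \<alpha> - 1 / real (card L))\<^sup>2))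
     \<le> real (card L) / real (card E) * (B * (17 * (real S + 1)\<^sup>2))"
    by (intro mult_left_mono) auto
  with rel_entropy_step[of t] Suc.IH show ?case
    unfolding of_nat_Suc distrib_right by linarith
qed

end

section \<open>Random linear constraints\<close>

lemma sum_words_prod_list:
  fixes f :: "'a \<Rightarrow> real"
  shows "(\<Sum>l\<in>words C m. prod_list (map f l)) = (\<Sum>c\<in>C. f c) ^ m"
  by (induction m) (simp_all add: sum_words_Suc sum_distrib_left[symmetric] sum_distrib_right[symmetric])

text \<open>Chernoff's bound with exponential parameter \<open>\<epsilon>\<close>: each counted word
  has weight at least \<open>exp (\<epsilon>\<^sup>2 * real m)\<close>, while the total weight
  factorises over the letters and is at most \<open>exp (\<epsilon>\<^sup>2 * real m / 2)\<close>
  times the number of words.\<close>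

lemma card_words_filter_gt_le:
  assumes C: "finite C" "C \<noteq> {}" and q: "(\<Sum>c\<in>C. of_bool (P c)) = q * real (card C)"
    and \<epsilon>: "\<epsilon> > 0"
  shows "real (card {l \<in> words C m. real (length (filter P l)) > (q + \<epsilon>) * real m})
    \<le> real (card C) ^ m * exp (- \<epsilon>\<^sup>2 * real m / 2)"
proof -
  define \<phi> :: "'a \<Rightarrow> real" where "\<phi> c = of_bool (P c) - q" for c
  have cC: "real (card C) > 0" using C by (simp add: card_gt_0_iff)
  have "0 \<le> q * real (card C)" "q * real (card C) \<le> 1 * real (card C)"
    unfolding q[symmetric] using sum_bounded_above[of C "\<lambda>c. of_bool (P c)" "1::real"]
    by (auto intro!: sum_nonneg)
  hence q01: "0 \<le> q" "q \<le> 1" using cC by (auto simp: zero_le_mult_iff)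
  have prod: "prod_list (map (\<lambda>c. exp (\<epsilon> * \<phi> c)) l) = exp (\<epsilon> * (real (length (filter P l)) - q * real (length l)))" for l
    by (induction l) (auto simp: \<phi>_def exp_add[symmetric] algebra_simps)
  let ?B = "{l \<in> words C m. real (length (filter P l)) > (q + \<epsilon>) * real m}"
  have "real (card ?B) * exp (\<epsilon>\<^sup>2 * real m) = (\<Sum>l\<in>?B. exp (\<epsilon>\<^sup>2 * real m))" by simp
  also have "\<dots> \<le> (\<Sum>l\<in>?B. prod_list (map (\<lambda>c. exp (\<epsilon> * \<phi> c)) l))"
  proof (intro sum_mono)
    fix l assume "l \<in> ?B"
    hence "\<epsilon> * (\<epsilon> * real m) \<le> \<epsilon> * (real (length (filter P l)) - q * real (length l))"
      using \<epsilon> by (intro mult_left_mono) (auto simp: words_def algebra_simps)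
    thus "exp (\<epsilon>\<^sup>2 * real m) \<le> prod_list (map (\<lambda>c. exp (\<epsilon> * \<phi> c)) l)"
      unfolding prod by (simp add: power2_eq_square)
  qed
  also have "\<dots> \<le> (\<Sum>l\<in>words C m. prod_list (map (\<lambda>c. exp (\<epsilon> * \<phi> c)) l))"
    using finite_words[OF C(1)] by (intro sum_mono2) (auto simp: prod)
  also have "\<dots> = (\<Sum>c\<in>C. exp (\<epsilon> * \<phi> c)) ^ m" by (rule sum_words_prod_list)
  also have "\<dots> \<le> (real (card C) * exp (\<epsilon>\<^sup>2 / 2)) ^ m"
  proof (intro power_mono sum_exp_mean_zero_le C)
    show "(\<Sum>c\<in>C. \<phi> c) = 0" using q by (simp only: \<phi>_def sum_subtractf) simp
    show "\<bar>\<phi> c\<bar> \<le> 1" for c using q01 by (auto simp: \<phi>_def)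
  qed (auto intro!: sum_nonneg)
  also have "\<dots> = real (card C) ^ m * exp (- \<epsilon>\<^sup>2 * real m / 2) * exp (\<epsilon>\<^sup>2 * real m)"
    by (simp add: power_mult_distrib exp_of_nat_mult[symmetric] exp_add[symmetric] field_simps)
  finally show ?thesis by simp
qed

text \<open>Measurability of the events is implicit: \<open>prob\<close> is \<open>0\<close> on non-measurable sets.\<close>

lemma (in prob_space) sum_prob_le:
  fixes w :: "'i \<Rightarrow> real"
  assumes "finite I" "\<And>i. i \<in> I \<Longrightarrow> w i \<ge> 0" "\<And>i. i \<in> I \<Longrightarrow> prob (X i) > 0"
    and le: "\<And>\<omega>. \<omega> \<in> space M \<Longrightarrow> (\<Sum>i\<in>I. w i * of_bool (\<omega> \<in> X i)) \<le> B"
  shows "(\<Sum>i\<in>I. w i * prob (X i)) \<le> B"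
proof -
  have X: "X i \<in> events" if "i \<in> I" for i
    using assms(3)[OF that] measure_notin_sets by force
  have "(\<Sum>i\<in>I. w i * prob (X i)) = (\<Sum>i\<in>I. expectation (\<lambda>\<omega>. w i * indicator (X i) \<omega>))"
    using X by (intro sum.cong) (auto simp: sets.Int_space_eq2)
  also have "\<dots> = expectation (\<lambda>\<omega>. \<Sum>i\<in>I. w i * indicator (X i) \<omega>)"
    using X by (intro Bochner_Integration.integral_sum[symmetric])
      (auto intro!: integrable_real_indicator simp: emeasure_eq_measure)
  also have "\<dots> \<le> expectation (\<lambda>_. B)"
  proof (rule integral_mono)
    show "(\<Sum>i\<in>I. w i * indicator (X i) \<omega>) \<le> B" if "\<omega> \<in> space M" for \<omega>
      using le[OF that] by (simp add: indicator_def of_bool_def)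
    show "integrable M (\<lambda>\<omega>. \<Sum>i\<in>I. w i * indicator (X i) \<omega>)"
      using X by (intro Bochner_Integration.integrable_sum)
        (auto intro!: integrable_real_indicator simp: emeasure_eq_measure)
  qed simp
  also have "\<dots> = B" by (simp add: prob_space)
  finally show ?thesis .
qed

text \<open>The map \<open>a \<mapsto> \<alpha> - a\<close> modulo \<open>p\<close>. Writing
  \<open>p - a\<close> avoids truncated subtraction, and the identity outside \<open>{..<p}\<close>
  is what \<open>permutes\<close> requires.\<close>

definition reflection :: "nat \<Rightarrow> nat \<Rightarrow> nat \<Rightarrow> nat" where
  "reflection p \<alpha> a = (if a < p then (\<alpha> + (p - a)) mod p else a)"

lemma reflection_less: "a < p \<Longrightarrow> reflection p \<alpha> a < p"
  by (simp add: reflection_def)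

lemma reflection_eq_iff:
  assumes "\<alpha> < p" "a < p" "b < p"
  shows "reflection p \<alpha> a = b \<longleftrightarrow> (a + b) mod p = \<alpha>"
proof
  assume "reflection p \<alpha> a = b"
  hence "(a + b) mod p = (a + (\<alpha> + (p - a))) mod p"
    using assms by (auto simp: reflection_def mod_add_right_eq)
  also have "a + (\<alpha> + (p - a)) = \<alpha> + p" using assms by simp
  finally show "(a + b) mod p = \<alpha>" using assms by simp
next
  assume "(a + b) mod p = \<alpha>"
  hence "reflection p \<alpha> a = ((a + b) mod p + (p - a)) mod p"
    using assms by (simp add: reflection_def)
  also have "\<dots> = ((a + b) + (p - a)) mod p" by (rule mod_add_left_eq)
  also have "(a + b) + (p - a) = b + p" using assms by simp
  finally show "reflection p \<alpha> a = b" using assms by simp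
qed

lemma reflection_reflection:
  "\<alpha> < p \<Longrightarrow> a < p \<Longrightarrow> reflection p \<alpha> (reflection p \<alpha> a) = a"
  by (subst reflection_eq_iff)
    (simp_all add: reflection_less reflection_eq_iff[THEN iffD1, of \<alpha> p a "reflection p \<alpha> a"] add.commute)

lemma reflection_permutes:
  assumes "\<alpha> < p"
  shows "reflection p \<alpha> permutes {..<p}"
proof (rule bij_imp_permutes)
  show "bij_betw (reflection p \<alpha>) {..<p} {..<p}"
    using assms by (intro bij_betw_byWitness[where f' = "reflection p \<alpha>"])
      (auto simp: reflection_reflection reflection_less)
qed (auto simp: reflection_def)

text \<open>
  The event \<open>a + b = \<alpha>\<close> is, up to its mean, a sum of products of mean-zero functions of \<open>a\<close> and of \<open>b\<close>,
  so that \<open>level_two_inequality\<close> applies without any use of complex characters.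
\<close>

definition centred :: "nat \<Rightarrow> nat \<Rightarrow> nat \<Rightarrow> real" where
  "centred p a b = of_bool (b = a) - 1 / real p"

lemma sum_centred: "a < p \<Longrightarrow> (\<Sum>b<p. centred p a b) = 0"
  by (simp add: centred_def sum_subtractf of_bool_def)

lemma abs_centred_le: "p > 0 \<Longrightarrow> \<bar>centred p a b\<bar> \<le> 1"
  by (auto simp: centred_def)

text \<open>Among the products of indicators only \<open>k = a\<close> can survive, and it does when
  \<open>b = reflection p \<alpha> a\<close>. The other terms of the expansion sum to
  \<open>- 1 / p - 1 / p + p / p\<^sup>2 = - 1 / p\<close>.\<close>

lemma of_bool_mod_eq_centred:
  assumes "\<alpha> < p" "a < p" "b < p"
  shows "of_bool ((a + b) mod p = \<alpha>) - 1 / real p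
     = (\<Sum>k<p. centred p k a * centred p (reflection p \<alpha> k) b)"
proof -
  let ?r = "reflection p \<alpha>"
  have p: "real p > 0" using assms by simp
  have r: "b = ?r k \<longleftrightarrow> k = ?r b" if "k < p" for k
    using that assms reflection_reflection by metis
  have "(\<Sum>k<p. centred p k a * centred p (?r k) b)
     = (\<Sum>k<p. of_bool (k = a) * of_bool (b = ?r k) - of_bool (k = a) / real p
          - of_bool (k = ?r b) / real p + 1 / (real p)\<^sup>2)"
    by (intro sum.cong refl) (auto simp: centred_def r algebra_simps power2_eq_square)
  also have "\<dots> = (\<Sum>k<p. of_bool (k = a) * of_bool (b = ?r k)) - (\<Sum>k<p. of_bool (k = a)) / real p
          - (\<Sum>k<p. of_bool (k = ?r b)) / real p + real p * (1 / (real p)\<^sup>2)"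
    by (simp only: sum.distrib sum_subtractf sum_divide_distrib) simp
  also have "(\<Sum>k<p. of_bool (k = a) * of_bool (b = ?r k)) = (of_bool (b = ?r a) :: real)"
    using assms by (simp add: of_bool_def if_distrib[of "\<lambda>c. c * _"] cong: if_cong)
  also have "(\<Sum>k<p. of_bool (k = a)) = (1 :: real)" using assms by (simp add: of_bool_def)
  also have "(\<Sum>k<p. of_bool (k = ?r b)) = (1 :: real)"
    using assms by (simp add: of_bool_def reflection_less)
  finally have "(\<Sum>k<p. centred p k a * centred p (?r k) b) = of_bool (b = ?r a) - 1 / real p"
    using p by (simp add: power2_eq_square)
  moreover have "b = ?r a \<longleftrightarrow> (a + b) mod p = \<alpha>" using reflection_eq_iff[OF assms] by auto
  ultimately show ?thesis by simp
qed

section \<open>Biases of the labels given partial information on the hidden pair\<close>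

definition hidden :: "nat \<Rightarrow> nat \<Rightarrow> ((nat \<Rightarrow> nat) \<times> (nat \<Rightarrow> nat)) set" where
  "hidden p N = ({..<N} \<rightarrow>\<^sub>E {..<p}) \<times> ({..<N} \<rightarrow>\<^sub>E {..<p})"

definition edge_label :: "nat \<Rightarrow> (nat \<Rightarrow> nat) \<times> (nat \<Rightarrow> nat) \<Rightarrow> nat \<times> nat \<Rightarrow> nat" where
  "edge_label p = (\<lambda>(x, y) (u, v). (x u + y v) mod p)"

lemma card_hidden: "card (hidden p N) = p ^ N * p ^ N"
  by (simp add: hidden_def card_cartesian_product card_PiE)

lemma PiE_lessThanD: "x \<in> {..<N} \<rightarrow>\<^sub>E {..<p} \<Longrightarrow> u < N \<Longrightarrow> x u < p" for p :: nat
  by (auto simp: PiE_iff)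

text \<open>Each label bias is a sum of \<open>p\<close> coefficients, one per \<open>k\<close>. For
  each of the \<open>p\<^sup>2\<close> choices of \<open>\<alpha>\<close> and \<open>k\<close>, the
  level-two inequality bounds the squared coefficients by \<open>4 * W\<close>; Cauchy-Schwarz over
  \<open>k\<close> costs another factor \<open>p\<close>.\<close>

lemma edge_label_level_two:
  fixes g :: "(nat \<Rightarrow> nat) \<times> (nat \<Rightarrow> nat) \<Rightarrow> real"
  assumes p: "p > 0" and g: "\<And>h. 0 \<le> g h \<and> g h \<le> 1" and pos: "0 < (\<Sum>h\<in>hidden p N. g h)"
  shows "(\<Sum>e\<in>{..<N} \<times> {..<N}. \<Sum>\<alpha>\<in>{..<p}.
      ((\<Sum>h\<in>hidden p N. g h * of_bool (edge_label p h e = \<alpha>)) / (\<Sum>h\<in>hidden p N. g h) - 1 / real (card {..<p}))\<^sup>2)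
    \<le> 4 * real p ^ 3 * (1 + ln (real (card (hidden p N)) / (\<Sum>h\<in>hidden p N. g h)))\<^sup>2"
proof -
  define G where "G = (\<Sum>h\<in>hidden p N. g h)"
  define W where "W = (1 + ln (real (card (hidden p N)) / G))\<^sup>2"
  define c where "c \<alpha> k u v = (\<Sum>h\<in>hidden p N. g h * (centred p k (fst h u) * centred p (reflection p \<alpha> k) (snd h v))) / G"
    for \<alpha> k u v
  have G: "G > 0" using pos by (simp add: G_def)
  have c: "(\<Sum>u<N. \<Sum>v<N. (c \<alpha> k u v)\<^sup>2) \<le> 4 * W" if "k < p" for \<alpha> k
  proof -
    define \<mu> where "\<mu> = G / (real p ^ N * real p ^ N)"
    have "(\<Sum>x\<in>{..<N} \<rightarrow>\<^sub>E {..<p}. \<Sum>y\<in>{..<N} \<rightarrow>\<^sub>E {..<p}. g (x, y))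
        = \<mu> * (real (card {..<p}) ^ card {..<N} * real (card {..<p}) ^ card {..<N})"
      using p by (simp add: \<mu>_def G_def hidden_def sum.cartesian_product)
    moreover have "\<mu> > 0" using G p by (simp add: \<mu>_def)
    ultimately have "(\<Sum>u<N. \<Sum>v<N. ((\<Sum>x\<in>{..<N} \<rightarrow>\<^sub>E {..<p}. \<Sum>y\<in>{..<N} \<rightarrow>\<^sub>E {..<p}.
           g (x, y) * (centred p k (x u) * centred p (reflection p \<alpha> k) (y v)))
         / (\<Sum>x\<in>{..<N} \<rightarrow>\<^sub>E {..<p}. \<Sum>y\<in>{..<N} \<rightarrow>\<^sub>E {..<p}. g (x, y)))\<^sup>2) \<le> 4 * (1 + ln (1 / \<mu>))\<^sup>2"
      using p g that
      by (intro level_two_inequality) (auto simp: sum_centred abs_centred_le reflection_less)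
    moreover have "1 / \<mu> = real (card (hidden p N)) / G"
      by (simp add: \<mu>_def card_hidden)
    ultimately show ?thesis
      by (simp add: c_def W_def G_def hidden_def sum.cartesian_product split_def)
  qed
  have pairs: "(\<Sum>e\<in>A \<times> B. f e) = (\<Sum>u\<in>A. \<Sum>v\<in>B. f (u, v))"
    for f :: "nat \<times> nat \<Rightarrow> real" and A B
    by (simp add: sum.cartesian_product split_def)
  have q: "(\<Sum>h\<in>hidden p N. g h * of_bool (edge_label p h (u, v) = \<alpha>)) / G - 1 / real p = (\<Sum>k<p. c \<alpha> k u v)"
    if "u < N" "v < N" "\<alpha> < p" for u v \<alpha>
  proof -
    define X where "X h = (of_bool (edge_label p h (u, v) = \<alpha>) :: real)" for h
    have X: "X h - 1 / real p = (\<Sum>k<p. centred p k (fst h u) * centred p (reflection p \<alpha> k) (snd h v))"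
      if "h \<in> hidden p N" for h
    proof -
      have "fst h \<in> {..<N} \<rightarrow>\<^sub>E {..<p}" "snd h \<in> {..<N} \<rightarrow>\<^sub>E {..<p}"
        using that unfolding hidden_def by (simp_all add: mem_Times_iff)
      hence "fst h u < p" "snd h v < p"
        using \<open>u < N\<close> \<open>v < N\<close> by (simp_all only: PiE_lessThanD)
      from of_bool_mod_eq_centred[OF \<open>\<alpha> < p\<close> this] show ?thesis
        by (simp only: X_def edge_label_def split_def fst_conv snd_conv)
    qed
    have "(\<Sum>h\<in>hidden p N. g h * X h) - G * (1 / real p) = (\<Sum>h\<in>hidden p N. g h * (X h - 1 / real p))"
      unfolding right_diff_distrib sum_subtractf G_def sum_distrib_right ..
    moreover have "(\<Sum>h\<in>hidden p N. g h * (X h - 1 / real p)) / G = (\<Sum>k<p. c \<alpha> k u v)"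
    proof -
      have "(\<Sum>h\<in>hidden p N. g h * (X h - 1 / real p))
        = (\<Sum>h\<in>hidden p N. g h * (\<Sum>k<p. centred p k (fst h u) * centred p (reflection p \<alpha> k) (snd h v)))"
        by (rule sum.cong) (simp_all only: X)
      moreover have "(\<Sum>h\<in>hidden p N. g h * (\<Sum>k<p. centred p k (fst h u) * centred p (reflection p \<alpha> k) (snd h v))) / G
        = (\<Sum>k<p. c \<alpha> k u v)"
        unfolding c_def sum_distrib_left sum_divide_distrib by (rule sum.swap)
      ultimately show ?thesis by (simp only:)
    qed
    moreover have "(\<Sum>h\<in>hidden p N. g h * X h) / G - 1 / real p = ((\<Sum>h\<in>hidden p N. g h * X h) - G * (1 / real p)) / G"
      using G by (simp add: diff_divide_distrib)
    ultimately have "(\<Sum>h\<in>hidden p N. g h * X h) / G - 1 / real p = (\<Sum>k<p. c \<alpha> k u v)"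
      by (simp only:)
    thus ?thesis by (simp only: X_def)
  qed
  have "(\<Sum>e\<in>{..<N} \<times> {..<N}. \<Sum>\<alpha>\<in>{..<p}.
      ((\<Sum>h\<in>hidden p N. g h * of_bool (edge_label p h e = \<alpha>)) / G - 1 / real (card {..<p}))\<^sup>2)
    = (\<Sum>u<N. \<Sum>v<N. \<Sum>\<alpha><p. (\<Sum>k<p. c \<alpha> k u v)\<^sup>2)"
    unfolding pairs card_lessThan by (intro sum.cong refl) (simp add: q)
  also have "\<dots> \<le> (\<Sum>u<N. \<Sum>v<N. \<Sum>\<alpha><p. (\<Sum>k<p. (c \<alpha> k u v)\<^sup>2) * real (card {..<p}))"
    by (intro sum_mono sum_squared_le_sum_of_squares)
  also have "\<dots> = real p * (\<Sum>\<alpha><p. \<Sum>k<p. \<Sum>u<N. \<Sum>v<N. (c \<alpha> k u v)\<^sup>2)"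
  proof -
    have "(\<Sum>u<N. \<Sum>v<N. \<Sum>\<alpha><p. (\<Sum>k<p. (c \<alpha> k u v)\<^sup>2) * real (card {..<p}))
      = (\<Sum>u<N. \<Sum>v<N. \<Sum>\<alpha><p. \<Sum>k<p. (c \<alpha> k u v)\<^sup>2) * real p"
      by (simp add: sum_distrib_right)
    also have "(\<Sum>u<N. \<Sum>v<N. \<Sum>\<alpha><p. \<Sum>k<p. (c \<alpha> k u v)\<^sup>2)
      = (\<Sum>e\<in>{..<N} \<times> {..<N}. \<Sum>i\<in>{..<p} \<times> {..<p}. (c (fst i) (snd i) (fst e) (snd e))\<^sup>2)"
      by (simp add: pairs)
    also have "\<dots> = (\<Sum>i\<in>{..<p} \<times> {..<p}. \<Sum>e\<in>{..<N} \<times> {..<N}. (c (fst i) (snd i) (fst e) (snd e))\<^sup>2)"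
      by (rule sum.swap)
    finally show ?thesis by (simp add: pairs)
  qed
  also have "\<dots> \<le> real p * (\<Sum>\<alpha><p. \<Sum>k<p. 4 * W)"
    by (intro mult_left_mono sum_mono c) auto
  also have "\<dots> = 4 * real p ^ 3 * W" by (simp add: power3_eq_cube)
  finally show ?thesis by (simp add: W_def G_def)
qed

text \<open>The bound \<open>1/2\<close> cancels the constant in
  \<open>rel_entropy_ge_event\<close>, leaving \<open>ln 2 * (2 * P - 1) \<le> 3/2 * Q\<close>. For
  \<open>P \<ge> 1/2\<close>, \<open>ln 2 \<ge> 2/3\<close> yields
  \<open>P + 1 - Q \<le> 13/9 + P / 9 \<le> 14/9\<close>; otherwise the sum is below
  \<open>3/2\<close>.\<close>

lemma (in hidden_labelling) advantage_le:
  assumes "rel_entropy \<Sigma> (yes t) (no t) \<le> 1/2"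
  shows "(\<Sum>s\<in>\<Sigma>. yes t s * of_bool (T s)) + (\<Sum>s\<in>\<Sigma>. no t s * of_bool (\<not> T s)) \<le> 14/9"
proof -
  define P where "P = (\<Sum>s\<in>\<Sigma>. yes t s * of_bool (T s))"
  define Q where "Q = (\<Sum>s\<in>\<Sigma>. no t s * of_bool (T s))"
  have PQ: "P = (\<Sum>s | s \<in> \<Sigma> \<and> T s. yes t s)" "Q = (\<Sum>s | s \<in> \<Sigma> \<and> T s. no t s)"
    using finite by (simp_all only: P_def Q_def sum_Collect_of_bool)
  have "(\<Sum>s\<in>\<Sigma>. no t s * of_bool (\<not> T s)) = (\<Sum>s\<in>\<Sigma>. no t s - no t s * of_bool (T s))"
    by (intro sum.cong) auto
  also have "\<dots> = 1 - Q" by (simp only: sum_subtractf sum_no_1 Q_def)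
  finally have no: "(\<Sum>s\<in>\<Sigma>. no t s * of_bool (\<not> T s)) = 1 - Q" .
  have "rel_entropy \<Sigma> (yes t) (no t) \<ge> 1/2 + ln 2 * (2 * P - 1) - 3/2 * Q"
    unfolding PQ using finite yes_nonneg no_nonneg no_eq_0D sum_yes_1 sum_no_1
    by (intro rel_entropy_ge_event) auto
  hence D: "ln 2 * (2 * P - 1) \<le> 3/2 * Q" using assms by linarith
  have "P \<le> 1"
    unfolding PQ sum_yes_1[of t, symmetric] using finite yes_nonneg by (intro sum_mono2) auto
  have "Q \<ge> 0" unfolding PQ using no_nonneg by (intro sum_nonneg) auto
  have "P + (1 - Q) \<le> 14/9"
  proof (cases "2 * P - 1 \<ge> 0")
    case True
    have "2/3 * (2 * P - 1) \<le> ln 2 * (2 * P - 1)"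
      using True ln2_ge_two_thirds by (intro mult_right_mono) auto
    hence "2/3 * (2 * P - 1) \<le> 3/2 * Q" using D by (rule order_trans)
    thus ?thesis using \<open>P \<le> 1\<close> by (simp add: field_simps)
  qed (use \<open>Q \<ge> 0\<close> in linarith)
  thus ?thesis by (simp add: no P_def)
qed

text \<open>Right endpoints are shifted by \<open>N\<close> to keep the two sides of the bipartite
  graph disjoint; \<open>reflection p \<alpha>\<close> encodes the linear equation with right-hand
  side \<open>\<alpha>\<close>.\<close>

definition stream_constraint :: "nat \<Rightarrow> nat \<Rightarrow> (nat \<times> nat) \<times> nat \<Rightarrow> ug_constraint" where
  "stream_constraint p N = (\<lambda>((u, v), \<alpha>). (u, N + v, reflection p \<alpha>))"

lemma stream_constraint_linear:
  assumes "2 * N \<le> n" "c \<in> ({..<N} \<times> {..<N}) \<times> {..<p}"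
  shows "stream_constraint p N c \<in> linear_constraints p n"
proof -
  obtain u v \<alpha> where c: "c = ((u, v), \<alpha>)" by (metis prod.exhaust)
  have "u < N" "v < N" and \<alpha>: "\<alpha> < p" using assms(2) by (auto simp: c)
  hence "u < n" "N + v < n" "u \<noteq> N + v" using assms(1) by linarith+
  moreover have "\<forall>a<p. \<forall>b<p. reflection p \<alpha> a = b \<longleftrightarrow> [a + b = \<alpha>] (mod p)"
    using \<alpha> by (simp add: reflection_eq_iff cong_def)
  ultimately show ?thesis
    using \<alpha> reflection_permutes[OF \<alpha>]
    by (auto simp: c stream_constraint_def linear_constraints_def ug_constraints_def)
qed

lemma linear_constraints_subset: "linear_constraints p n \<subseteq> ug_constraints p n"
  by (auto simp: linear_constraints_def)

lemma satisfies_stream_constraint: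
  assumes "\<alpha> < p" "z u < p" "z (N + v) < p"
  shows "satisfies z (stream_constraint p N ((u, v), \<alpha>)) \<longleftrightarrow> (z u + z (N + v)) mod p = \<alpha>"
  using assms by (simp add: satisfies_def stream_constraint_def reflection_eq_iff)

lemma planted_fully_satisfiable:
  assumes n: "2 * N \<le> n" and p: "p > 0" and h: "h \<in> hidden p N" and l: "set l \<subseteq> {..<N} \<times> {..<N}"
  shows "fully_satisfiable p n (map (\<lambda>e. stream_constraint p N (e, edge_label p h e)) l)"
proof -
  obtain x y where xy: "h = (x, y)" "x \<in> {..<N} \<rightarrow>\<^sub>E {..<p}" "y \<in> {..<N} \<rightarrow>\<^sub>E {..<p}"
    using h by (auto simp: hidden_def)
  \<comment> \<open>\<open>x\<close> and \<open>y\<close> are glued together. Any remaining vertex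
    gets \<open>0\<close>; the value \<open>undefined\<close> outside \<open>{..<n}\<close> is
    demanded by the extensional function space.\<close>
  define z where "z i = (if i < N then x i else if i < 2 * N then y (i - N) else if i < n then 0 else undefined)" for i
  have zx: "z u = x u" "z u < p" if "u < N" for u
    using that PiE_lessThanD[OF xy(2)] by (simp_all add: z_def)
  have zy: "z (N + v) = y v" "z (N + v) < p" if "v < N" for v
    using that PiE_lessThanD[OF xy(3)] by (simp_all add: z_def)
  have "z i < p" if "i < n" for i
    using p PiE_lessThanD[OF xy(2)] PiE_lessThanD[OF xy(3)] by (auto simp: z_def that)
  moreover have "z i = undefined" if "\<not> i < n" for i
    using n that by (simp add: z_def)
  ultimately have z: "z \<in> assignments p n" by (auto simp: assignments_def)
  have "satisfies z (stream_constraint p N (e, edge_label p h e))" if "e \<in> set l" for e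
  proof -
    obtain u v where e: "e = (u, v)" "u < N" "v < N" using subsetD[OF l \<open>e \<in> set l\<close>] by auto
    show ?thesis
      using p zx[OF e(2)] zy[OF e(3)]
      by (simp add: e satisfies_stream_constraint edge_label_def xy)
  qed
  hence "num_satisfied z (map (\<lambda>e. stream_constraint p N (e, edge_label p h e)) l) = length l"
    by (simp add: num_satisfied_def filter_map o_def)
  thus ?thesis using z by (auto simp: fully_satisfiable_def)
qed

text \<open>A fixed assignment satisfies a constraint with uniform label with probability exactly
  \<open>1 / p\<close>, so the tail bound applies. The union bound over \<open>p ^ n\<close>
  assignments is affordable because \<open>K * N\<close> is a large multiple of \<open>N\<close> and
  \<open>n \<le> 3 * N\<close>.\<close>

lemma card_far_from_satisfiable:
  fixes \<epsilon> :: real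
  assumes p: "p \<ge> 2" and N: "N > 0" and n: "2 * N \<le> n" "n \<le> 3 * N" and \<epsilon>: "\<epsilon> > 0"
    and K: "6 * ln (real p) + 18 \<le> \<epsilon>\<^sup>2 * real K"
  defines "C \<equiv> ({..<N} \<times> {..<N}) \<times> {..<p}"
  shows "9/10 * real (card C) ^ (K * N) \<le>
    real (card {l \<in> words C (K * N). satisfiable_at_most p n (1 / real p + \<epsilon>) (map (stream_constraint p N) l)})"
proof -
  define m where "m = K * N"
  define sat where "sat z = (\<lambda>c. satisfies z (stream_constraint p N c))" for z
  define bad where "bad z = {l \<in> words C m. real (length (filter (sat z) l)) > (1 / real p + \<epsilon>) * real m}" for z
  let ?G = "{l \<in> words C m. satisfiable_at_most p n (1 / real p + \<epsilon>) (map (stream_constraint p N) l)}"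
  have C: "finite C" "C \<noteq> {}" using p N by (auto simp: C_def lessThan_empty_iff)
  have bad: "real (card (bad z)) \<le> real (card C) ^ m * exp (- \<epsilon>\<^sup>2 * real m / 2)" if z: "z \<in> assignments p n" for z
    unfolding bad_def
  proof (rule card_words_filter_gt_le[OF C _ \<epsilon>])
    have zp: "z i < p" if "i < n" for i using z that by (auto simp: assignments_def PiE_iff)
    have "(\<Sum>c\<in>C. of_bool (sat z c)) = (\<Sum>e\<in>{..<N} \<times> {..<N}. \<Sum>\<alpha><p. of_bool (sat z (e, \<alpha>)) :: real)"
      unfolding C_def sum.cartesian_product[of _ "{..<p}" "{..<N} \<times> {..<N}"] by (simp only: split_def prod.collapse)
    also have "\<dots> = (\<Sum>e\<in>{..<N} \<times> {..<N}. 1)"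
    proof (intro sum.cong refl)
      fix e assume "e \<in> {..<N} \<times> {..<N}"
      then obtain u v where e: "e = (u, v)" "u < N" "v < N" by auto
      hence "u < n" "N + v < n" using n by auto
      hence "(\<Sum>\<alpha><p. of_bool (sat z (e, \<alpha>)) :: real) = (\<Sum>\<alpha><p. of_bool ((z u + z (N + v)) mod p = \<alpha>))"
        by (intro sum.cong refl) (simp add: sat_def e satisfies_stream_constraint zp)
      also have "\<dots> = 1" using p by (simp add: of_bool_def)
      finally show "(\<Sum>\<alpha><p. of_bool (sat z (e, \<alpha>)) :: real) = 1" .
    qed
    also have "\<dots> = 1 / real p * real (card C)"
      using p by (simp add: C_def card_cartesian_product)
    finally show "(\<Sum>c\<in>C. of_bool (sat z c)) = 1 / real p * real (card C)" .
  qed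
  have fin: "finite (assignments p n)" "card (assignments p n) = p ^ n"
    by (auto simp: assignments_def finite_PiE card_PiE)
  have cover: "words C m \<subseteq> ?G \<union> (\<Union>z\<in>assignments p n. bad z)"
  proof
    fix l assume l: "l \<in> words C m"
    have "num_satisfied z (map (stream_constraint p N) l) = length (filter (sat z) l)" for z
      by (simp add: num_satisfied_def filter_map o_def sat_def)
    thus "l \<in> ?G \<union> (\<Union>z\<in>assignments p n. bad z)"
      using l by (auto simp: satisfiable_at_most_def bad_def words_def not_le)
  qed
  have "real (card C) ^ m = real (card (words C m))" using C by (simp add: card_words)
  also have "\<dots> \<le> real (card (?G \<union> (\<Union>z\<in>assignments p n. bad z)))"
    using cover fin finite_words[OF C(1)]
    by (intro of_nat_mono card_mono) (auto simp: bad_def)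
  also have "\<dots> \<le> real (card ?G + card (\<Union>z\<in>assignments p n. bad z))"
    by (intro of_nat_mono card_Un_le)
  also have "\<dots> \<le> real (card ?G + (\<Sum>z\<in>assignments p n. card (bad z)))"
    using fin by (intro of_nat_mono add_left_mono card_UN_le)
  also have "\<dots> \<le> real (card ?G) + (\<Sum>z\<in>assignments p n. real (card C) ^ m * exp (- \<epsilon>\<^sup>2 * real m / 2))"
    by (simp only: of_nat_add of_nat_sum) (intro add_left_mono sum_mono bad)
  also have "\<dots> = real (card ?G) + real (card C) ^ m * (real p ^ n * exp (- \<epsilon>\<^sup>2 * real m / 2))"
    by (simp add: fin)
  \<comment> \<open>The hypothesis on \<open>K\<close> makes the exponent at most
    \<open>- 9 * N\<close>, and \<open>exp (- 9) \<le> 1/10\<close>.\<close>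
  also have "real p ^ n * exp (- \<epsilon>\<^sup>2 * real m / 2) \<le> 1/10"
  proof -
    define a where "a = ln (real p) * real N"
    have "real n * ln (real p) \<le> (3 * real N) * ln (real p)"
      using n p by (intro mult_right_mono) auto
    hence "real n * ln (real p) \<le> 3 * a" by (simp add: a_def mult_ac)
    moreover have "(6 * ln (real p) + 18) * real N \<le> \<epsilon>\<^sup>2 * real K * real N"
      using K by (intro mult_right_mono) auto
    hence "6 * a + 18 * real N \<le> \<epsilon>\<^sup>2 * real m" by (simp add: a_def m_def algebra_simps)
    moreover have "real N \<ge> 1" using N by simp
    ultimately have "real n * ln (real p) - \<epsilon>\<^sup>2 * real m / 2 \<le> - 9" by linarith
    hence "exp (real n * ln (real p) - \<epsilon>\<^sup>2 * real m / 2) \<le> exp (- 9)" by simp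
    also have "\<dots> \<le> 1/10" using exp_ge_add_one_self[of 9] by (simp add: exp_minus field_simps)
    also have "exp (real n * ln (real p) - \<epsilon>\<^sup>2 * real m / 2) = real p ^ n * exp (- \<epsilon>\<^sup>2 * real m / 2)"
    proof -
      have "real p ^ n = exp (real n * ln (real p))"
        unfolding exp_of_nat_mult using p by simp
      thus ?thesis by (simp only: exp_add[symmetric]) simp
    qed
    finally show ?thesis .
  qed
  finally have "real (card C) ^ m \<le> real (card ?G) + real (card C) ^ m * (1/10)"
    by (simp add: mult_left_mono)
  thus ?thesis unfolding m_def by linarith
qed

section \<open>Runs of a streaming algorithm\<close>

lemma run_from_snoc:
  "run_from A \<omega> t s (es @ [e]) = alg_step A \<omega> (t + length es) (run_from A \<omega> t s es) e"
  by (induction es arbitrary: t s) auto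

lemma length_run_from:
  assumes "\<And>t s e. e \<in> X \<Longrightarrow> length s = S \<Longrightarrow> length (alg_step A \<omega> t s e) = S"
    and "set es \<subseteq> X" "length s = S"
  shows "length (run_from A \<omega> t s es) = S"
  using assms(2,3) by (induction es arbitrary: t s) (auto simp: assms(1))

lemma prob_space_coin_tape: "prob_space coin_tape"
  unfolding coin_tape_def by (intro prob_space_PiM measure_pmf.prob_space_axioms)

section \<open>Space bounds\<close>

text \<open>The common core of all three tasks. \<open>Y\<close> and \<open>Z\<close> express
  success on the two kinds of instance; \<open>R\<close> is a test of the output and the stream
  length alone that separates them. On each tape the run is deterministic, so for large
  \<open>n\<close> the two acceptance rates through \<open>R\<close> sum to at most
  \<open>14/9\<close>, contradicting the success probabilities averaged over tapes.\<close>

lemma streaming_space_bound: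
  fixes A :: "'o streaming_alg" and \<epsilon> :: real
  assumes p: "p \<ge> 2" and n: "n \<ge> 2" and \<epsilon>: "\<epsilon> > 0"
    and K: "6 * ln (real p) + 18 \<le> \<epsilon>\<^sup>2 * real K"
    and init: "\<And>\<omega>. length (alg_init A \<omega>) = S"
    and step: "\<And>\<omega> t s e. e \<in> ug_constraints p n \<Longrightarrow> length s = S \<Longrightarrow> length (alg_step A \<omega> t s e) = S"
    and yes: "\<And>I. I \<in> linear_instances p n \<Longrightarrow> I \<noteq> [] \<Longrightarrow> fully_satisfiable p n I \<Longrightarrow>
      success_prob A I (Y I) \<ge> 9/10 \<and> (\<forall>v. Y I v \<longrightarrow> R (length I) v)"
    and no: "\<And>I. I \<in> linear_instances p n \<Longrightarrow> I \<noteq> [] \<Longrightarrow> satisfiable_at_most p n (1 / real p + \<epsilon>) I \<Longrightarrow>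
      success_prob A I (Z I) \<ge> 9/10 \<and> (\<forall>v. Z I v \<longrightarrow> \<not> R (length I) v)"
  shows "real n \<le> 1632 * real K * real p ^ 4 * (real S)\<^sup>2"
proof (rule ccontr)
  assume "\<not> ?thesis"
  hence large: "1632 * real K * real p ^ 4 * (real S)\<^sup>2 < real n" by simp
  define N where "N = n div 2"
  have N: "N > 0" "2 * N \<le> n" "n \<le> 3 * N" using n by (auto simp: N_def)
  define E where "E = {..<N} \<times> {..<N}"
  define L where "L = {..<p}"
  define H where "H = hidden p N"
  define \<Sigma> :: "bool list set" where "\<Sigma> = {s. length s = S}"
  define m where "m = K * N"
  \<comment> \<open>This makes the streams nonempty, as the hypotheses on success require.\<close>
  have "K > 0"
  proof (rule ccontr)
    assume "\<not> ?thesis"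
    moreover have "ln (real p) \<ge> 0" using p by simp
    ultimately show False using K by simp
  qed
  hence m: "m > 0" using N by (simp add: m_def)
  have card: "card E = N * N" "card L = p" "card (E \<times> L) = N * N * p"
    by (simp_all add: E_def L_def card_cartesian_product)
  have fin: "finite H" "finite E" "finite L" "finite \<Sigma>" and ne: "H \<noteq> {}" "E \<noteq> {}" "L \<noteq> {}"
    using p N finite_lists_length_eq[of "UNIV :: bool set" S]
    by (auto simp: H_def hidden_def E_def L_def \<Sigma>_def finite_PiE lessThan_empty_iff PiE_eq_empty_iff)
  have card\<Sigma>: "card \<Sigma> = 2 ^ S"
    using card_lists_length_eq[of "UNIV :: bool set" S] by (simp add: \<Sigma>_def)
  define run where "run \<omega> l = run_from A \<omega> 0 (alg_init A \<omega>) (map (stream_constraint p N) l)" for \<omega> l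
  define F where "F \<omega> t s c = alg_step A \<omega> t s (stream_constraint p N c)" for \<omega> t s c
  have stream: "stream_constraint p N c \<in> ug_constraints p n" if "c \<in> E \<times> L" for c
    using that unfolding E_def L_def
    by (intro subsetD[OF linear_constraints_subset stream_constraint_linear[OF N(2)]])
  have hidden: "hidden_labelling H E L (edge_label p) \<Sigma> (run \<omega>) (F \<omega>)" for \<omega>
  proof
    show "edge_label p h e \<in> L" for h e
      using p by (auto simp: edge_label_def L_def split: prod.splits)
    show "F \<omega> t s c \<in> \<Sigma>" if "s \<in> \<Sigma>" "c \<in> E \<times> L" for t s c
      using that step[OF stream] by (simp add: F_def \<Sigma>_def)
    show "run \<omega> l \<in> \<Sigma>" if "set l \<subseteq> E \<times> L" for l
    proof -
      have "set (map (stream_constraint p N) l) \<subseteq> ug_constraints p n" using that stream by auto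
      from length_run_from[OF step this init] show ?thesis by (simp add: run_def \<Sigma>_def)
    qed
    show "run \<omega> (l @ [c]) = F \<omega> (length l) (run \<omega> l) c" for l c
      by (simp add: run_def F_def run_from_snoc)
  qed (fact fin ne)+
  define plant where "plant h = map (\<lambda>e. (e, edge_label p h e))" for h
  define acc where "acc \<omega> l = R m (alg_out A \<omega> m (run \<omega> l))" for \<omega> l
  have advantage: "(\<Sum>h\<in>H. \<Sum>l\<in>words E m. of_bool (acc \<omega> (plant h l))) / (real (card H) * real (card E) ^ m)
      + (\<Sum>l\<in>words (E \<times> L) m. of_bool (\<not> acc \<omega> l)) / real (card (E \<times> L)) ^ m \<le> 14/9" for \<omega>
  proof -
    interpret hl: hidden_labelling H E L "edge_label p" \<Sigma> "run \<omega>" "F \<omega>" by (rule hidden)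
    have "rel_entropy \<Sigma> (hl.yes m) (hl.no m) \<le> 1/2"
    \<comment> \<open>Without memory the entropy vanishes; this turns \<open>(S + 1)\<^sup>2\<close> into a multiple of \<open>S\<^sup>2\<close>.\<close>
    proof (cases "S = 0")
      case True
      hence "\<Sigma> = {[]}" by (auto simp: \<Sigma>_def)
      thus ?thesis using hl.rel_entropy_singleton by simp
    next
      case False
      have "rel_entropy \<Sigma> (hl.yes m) (hl.no m)
        \<le> real m * (real (card L) / real (card E) * (4 * real p ^ 3 * (17 * (real S + 1)\<^sup>2)))"
        using p card\<Sigma> unfolding E_def L_def H_def
        by (intro hl.rel_entropy_le[unfolded E_def L_def H_def] edge_label_level_two) auto
      also have "\<dots> = 68 * real K * real p ^ 4 * (real S + 1)\<^sup>2 / real N"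
        using N by (simp add: card m_def power2_eq_square power3_eq_cube power4_eq_xxxx)
      also have "\<dots> \<le> 68 * real K * real p ^ 4 * (2 * real S)\<^sup>2 / real N"
        using False by (intro divide_right_mono mult_left_mono power_mono) auto
      \<comment> \<open>With \<open>68 * 4 = 272\<close>, the bound \<open>1/2\<close> amounts to
        \<open>544 * K * p ^ 4 * S\<^sup>2 \<le> N\<close>; the factor 3 in
        \<open>n \<le> 3 * N\<close> turns 544 into 1632.\<close>
      also have "\<dots> \<le> 1/2"
      proof -
        have "1632 * real K * real p ^ 4 * (real S)\<^sup>2 \<le> 3 * real N" using large N by linarith
        thus ?thesis using N by (simp add: power_mult_distrib field_simps)
      qed
      finally show ?thesis .
    qed
    from hl.advantage_le[OF this, of "\<lambda>s. R m (alg_out A \<omega> m s)"]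
    show ?thesis
      by (simp add: hl.sum_yes hl.sum_no acc_def plant_def hl.planted_def card card_cartesian_product)
  qed
  define inst where "inst = map (stream_constraint p N)"
  define G where "G = {l \<in> words (E \<times> L) m. satisfiable_at_most p n (1 / real p + \<epsilon>) (inst l)}"
  have inst: "inst l \<in> linear_instances p n" "inst l \<noteq> []" "length (inst l) = m" if "l \<in> words (E \<times> L) m" for l
    using that m stream_constraint_linear[OF N(2)]
    by (auto simp: inst_def linear_instances_def words_def E_def L_def in_lists_conv_set subset_iff)
  have out: "alg_output A \<omega> (inst l) = alg_out A \<omega> m (run \<omega> l)" if "l \<in> words (E \<times> L) m" for \<omega> l
    using inst(3)[OF that] by (simp add: alg_output_def run_def inst_def)
  have plant: "plant h l \<in> words (E \<times> L) m" if "l \<in> words E m" for h l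
    using that p by (auto simp: plant_def words_def edge_label_def L_def split: prod.splits)
  have yes': "success_prob A (inst (plant h l)) (Y (inst (plant h l))) \<ge> 9/10"
    "Y (inst (plant h l)) v \<Longrightarrow> R m v" if "h \<in> H" "l \<in> words E m" for h l v
  proof -
    have "inst (plant h l) = map (\<lambda>e. stream_constraint p N (e, edge_label p h e)) l"
      by (simp add: inst_def plant_def o_def)
    hence "fully_satisfiable p n (inst (plant h l))"
      using planted_fully_satisfiable[OF N(2)] p that by (simp add: H_def words_def E_def)
    from yes[OF inst(1,2)[OF plant[OF that(2)]] this]
    show "success_prob A (inst (plant h l)) (Y (inst (plant h l))) \<ge> 9/10"
      "Y (inst (plant h l)) v \<Longrightarrow> R m v"
      using inst(3)[OF plant[OF that(2)]] by auto
  qed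
  have no': "success_prob A (inst l) (Z (inst l)) \<ge> 9/10" "Z (inst l) v \<Longrightarrow> \<not> R m v" if "l \<in> G" for l v
  proof -
    have l: "l \<in> words (E \<times> L) m" using that by (simp add: G_def)
    from no[OF inst(1,2)[OF l]] that
    show "success_prob A (inst l) (Z (inst l)) \<ge> 9/10" "Z (inst l) v \<Longrightarrow> \<not> R m v"
      using inst(3)[OF l] by (auto simp: G_def)
  qed
  \<comment> \<open>Planted streams \<open>J\<close> and far-from-satisfiable streams
    \<open>G\<close> form one index set, weighted by their probabilities in the two cases, so that
    one averaging over tapes treats both.\<close>
  define J where "J = H \<times> words E m"
  define w1 where "w1 = 1 / (real (card H) * real (card E) ^ m)"
  define w2 where "w2 = 1 / real (card (E \<times> L)) ^ m"
  define X where "X = case_sum (\<lambda>(h, l). {\<omega> \<in> space coin_tape. Y (inst (plant h l)) (alg_output A \<omega> (inst (plant h l)))})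
    (\<lambda>l. {\<omega> \<in> space coin_tape. Z (inst l) (alg_output A \<omega> (inst l))})"
  have finJ: "finite J" "finite G"
    using fin finite_words[OF fin(2)] finite_words[of "E \<times> L"] by (auto simp: J_def G_def)
  have w: "w1 > 0" "w2 > 0" using fin ne by (auto simp: w1_def w2_def card_gt_0_iff)
  have prob: "measure coin_tape (X i) \<ge> 9/10" if "i \<in> J <+> G" for i
    using that yes'(1) no'(1) by (auto simp: X_def J_def success_prob_def)
  interpret coin: prob_space coin_tape by (rule prob_space_coin_tape)
  let ?w = "case_sum (\<lambda>_. w1) (\<lambda>_. w2)"
  have "(\<Sum>i\<in>J <+> G. ?w i * measure coin_tape (X i)) \<le> 14/9"
  proof (rule coin.sum_prob_le)
    show "measure coin_tape (X i) > 0" if "i \<in> J <+> G" for i using prob[OF that] by simp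
    fix \<omega> assume "\<omega> \<in> space coin_tape"
    have "(\<Sum>i\<in>J <+> G. ?w i * of_bool (\<omega> \<in> X i))
      = (\<Sum>i\<in>J. w1 * of_bool (\<omega> \<in> X (Inl i))) + (\<Sum>l\<in>G. w2 * of_bool (\<omega> \<in> X (Inr l)))"
      using finJ by (simp only: sum.Plus o_def sum.case)
    also have "(\<Sum>i\<in>J. w1 * of_bool (\<omega> \<in> X (Inl i))) \<le> (\<Sum>i\<in>J. w1 * of_bool (acc \<omega> (plant (fst i) (snd i))))"
      using w yes'(2) out[OF plant] by (intro sum_mono) (auto simp: J_def X_def acc_def)
    also have "(\<Sum>l\<in>G. w2 * of_bool (\<omega> \<in> X (Inr l))) \<le> (\<Sum>l\<in>G. w2 * of_bool (\<not> acc \<omega> l))"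
      using w no'(2) out by (intro sum_mono) (auto simp: G_def X_def acc_def)
    \<comment> \<open>Streams outside \<open>G\<close> carry no guarantee, but their terms are
      nonnegative.\<close>
    also have "\<dots> \<le> (\<Sum>l\<in>words (E \<times> L) m. w2 * of_bool (\<not> acc \<omega> l))"
      using w fin by (intro sum_mono2) (auto simp: G_def finite_words)
    also have "(\<Sum>i\<in>J. w1 * of_bool (acc \<omega> (plant (fst i) (snd i)))) + (\<Sum>l\<in>words (E \<times> L) m. w2 * of_bool (\<not> acc \<omega> l))
      = (\<Sum>h\<in>H. \<Sum>l\<in>words E m. of_bool (acc \<omega> (plant h l))) / (real (card H) * real (card E) ^ m)
      + (\<Sum>l\<in>words (E \<times> L) m. of_bool (\<not> acc \<omega> l)) / real (card (E \<times> L)) ^ m"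
      by (simp only: J_def sum.cartesian_product split_def sum_distrib_left[symmetric] w1_def w2_def) simp
    also have "\<dots> \<le> 14/9" by (rule advantage)
    finally show "(\<Sum>i\<in>J <+> G. ?w i * of_bool (\<omega> \<in> X i)) \<le> 14/9" by simp
  qed (use finJ w in auto)
  moreover have "(\<Sum>i\<in>J <+> G. ?w i * (9/10)) \<le> (\<Sum>i\<in>J <+> G. ?w i * measure coin_tape (X i))"
    using w by (intro sum_mono mult_left_mono prob) auto
  moreover have "(\<Sum>i\<in>J <+> G. ?w i * (9/10)) = 9/10 * (w1 * real (card J) + w2 * real (card G))"
    using finJ by (simp add: sum.Plus)
  moreover have "w1 * real (card J) = 1"
    using fin ne by (simp add: w1_def J_def card_cartesian_product card_words card_gt_0_iff)
  moreover have "w2 * real (card G) \<ge> 9/10"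
  proof -
    have "9/10 * real (card (E \<times> L)) ^ m \<le> real (card G)"
      using card_far_from_satisfiable[OF p N \<epsilon> K]
      unfolding G_def inst_def E_def L_def m_def .
    moreover have "real (card (E \<times> L)) ^ m > 0" using w(2) by (simp add: w2_def)
    ultimately show ?thesis by (simp add: w2_def le_divide_eq)
  qed
  \<comment> \<open>The weighted sum is at least \<open>9/10 * (1 + 9/10) = 171/100\<close>, which
    exceeds \<open>14/9\<close>.\<close>
  ultimately show False by simp
qed

section \<open>Specialisation to distinguishing and to approximation\<close>

lemma streaming_algorithmD:
  assumes "streaming_algorithm p n S M A"
  shows "length (alg_init A \<omega>) = S"
    "e \<in> ug_constraints p n \<Longrightarrow> length s = S \<Longrightarrow> length (alg_step A \<omega> t s e) = S"
  using assms by (auto simp: streaming_algorithm_def)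

lemma linear_instances_subset: "linear_instances p n \<subseteq> ug_instances p n"
  using linear_constraints_subset by (auto simp: linear_instances_def ug_instances_def)

lemma distinguishes_space_bound:
  assumes "p \<ge> 2" "n \<ge> 2" "\<epsilon> > 0" "6 * ln (real p) + 18 \<le> \<epsilon>\<^sup>2 * real K"
    and "streaming_algorithm p n S (count_space UNIV) A"
    and "distinguishes p n (1 / real p + \<epsilon>) (linear_instances p n) A"
  shows "real n \<le> 1632 * real K * real p ^ 4 * (real S)\<^sup>2"
  using assms(6) unfolding distinguishes_def
  by (intro streaming_space_bound[OF assms(1-4) streaming_algorithmD[OF assms(5)],
        where Y = "\<lambda>_ b. b" and Z = "\<lambda>_ b. \<not> b" and R = "\<lambda>_ b. b"]) auto

lemma num_satisfied_le_length: "num_satisfied x I \<le> length I"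
  by (simp add: num_satisfied_def)

lemma finite_assignments: "finite (assignments p n)"
  by (simp add: assignments_def finite_PiE)

lemma opt_value_fully_satisfiable:
  assumes "fully_satisfiable p n I"
  shows "opt_value p n I = length I"
  unfolding opt_value_def
proof (rule Max_eqI)
  show "length I \<in> (\<lambda>x. num_satisfied x I) ` assignments p n"
    using assms by (force simp: fully_satisfiable_def)
qed (auto simp: finite_assignments num_satisfied_le_length)

lemma opt_value_le:
  assumes "satisfiable_at_most p n \<gamma> I" "p > 0"
  shows "real (opt_value p n I) \<le> \<gamma> * real (length I)"
proof -
  have "(\<lambda>i\<in>{..<n}. 0) \<in> assignments p n" using assms(2) by (auto simp: assignments_def)
  hence "opt_value p n I \<in> (\<lambda>x. num_satisfied x I) ` assignments p n"
    unfolding opt_value_def by (intro Max_in) (auto simp: finite_assignments)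
  thus ?thesis using assms(1) by (auto simp: satisfiable_at_most_def)
qed

text \<open>The separating test is the threshold \<open>m / f\<close> for streams of length
  \<open>m\<close>. On satisfiable instances the optimum is \<open>m\<close>, so
  \<open>T \<ge> m / f\<close>; on the others \<open>T\<close> is at most the optimum, hence at most
  \<open>(1 / p + \<epsilon>) * m < m / f\<close>, strictly because \<open>I\<close> is
  nonempty.\<close>

lemma approximates_opt_space_bound:
  assumes p: "p \<ge> 2" and "n \<ge> 2" "\<epsilon> > 0" "6 * ln (real p) + 18 \<le> \<epsilon>\<^sup>2 * real K"
    and f: "f > 0" "1 / real p + \<epsilon> < 1 / f"
    and A: "streaming_algorithm p n S borel A" "approximates_opt p n f A"
  shows "real n \<le> 1632 * real K * real p ^ 4 * (real S)\<^sup>2"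
proof (rule streaming_space_bound[OF assms(1-4) streaming_algorithmD[OF A(1)],
      where Y = "\<lambda>I T. real (opt_value p n I) / f \<le> T \<and> T \<le> real (opt_value p n I)"
        and Z = "\<lambda>I T. real (opt_value p n I) / f \<le> T \<and> T \<le> real (opt_value p n I)"
        and R = "\<lambda>m T. real m / f \<le> T"])
  fix I assume I: "I \<in> linear_instances p n" "I \<noteq> []"
  have *: "success_prob A I (\<lambda>T. real (opt_value p n I) / f \<le> T \<and> T \<le> real (opt_value p n I)) \<ge> 9/10"
    using A(2) I(1) linear_instances_subset by (auto simp: approximates_opt_def)
  {
    assume "fully_satisfiable p n I"
    thus "success_prob A I (\<lambda>T. real (opt_value p n I) / f \<le> T \<and> T \<le> real (opt_value p n I)) \<ge> 9/10 \<and>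
      (\<forall>v. real (opt_value p n I) / f \<le> v \<and> v \<le> real (opt_value p n I) \<longrightarrow> real (length I) / f \<le> v)"
      using * by (simp add: opt_value_fully_satisfiable)
  next
    assume sat: "satisfiable_at_most p n (1 / real p + \<epsilon>) I"
    have "real (opt_value p n I) \<le> (1 / real p + \<epsilon>) * real (length I)"
      using opt_value_le[OF sat] p by simp
    also have "\<dots> < 1 / f * real (length I)" using f I by (intro mult_strict_right_mono) auto
    finally have "real (opt_value p n I) < real (length I) / f" by simp
    thus "success_prob A I (\<lambda>T. real (opt_value p n I) / f \<le> T \<and> T \<le> real (opt_value p n I)) \<ge> 9/10 \<and>
      (\<forall>v. real (opt_value p n I) / f \<le> v \<and> v \<le> real (opt_value p n I) \<longrightarrow> \<not> real (length I) / f \<le> v)"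
      using * by force
  }
qed

theorem theorem1p1:
  fixes p :: nat and \<epsilon> :: real
  assumes "p \<ge> 2" and "0 < \<epsilon>" and "\<epsilon> < real p - 1"
  shows "\<exists>c::real. c > 0 \<and> (\<forall>n::nat. n \<ge> 2 \<longrightarrow>
    (\<forall>(S::nat) (A::real streaming_alg).
       streaming_algorithm p n S borel A \<longrightarrow>
       approximates_opt p n (real p - \<epsilon>) A \<longrightarrow>
       real S \<ge> c * sqrt (real n)) \<and>
    (\<forall>(S::nat) (A::bool streaming_alg).
       streaming_algorithm p n S (count_space UNIV) A \<longrightarrow>
       distinguishes p n (1 / real p + \<epsilon>) (ug_instances p n) A \<longrightarrow>
       real S \<ge> c * sqrt (real n)) \<and>
    (\<forall>(S::nat) (A::bool streaming_alg).
       streaming_algorithm p n S (count_space UNIV) A \<longrightarrow>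
       distinguishes p n (1 / real p + \<epsilon>) (linear_instances p n) A \<longrightarrow>
       real S \<ge> c * sqrt (real n)))"
proof -
  define f where "f = real p - \<epsilon>"
  \<comment> \<open>Half of the gap keeps \<open>1 / p + \<delta>\<close> strictly below
    \<open>1 / f\<close>, as the approximation task needs; the minimum with
    \<open>\<epsilon>\<close> lets one \<open>K\<close> serve the distinguishing tasks too.\<close>
  define \<delta> where "\<delta> = min \<epsilon> ((1 / f - 1 / real p) / 2)"
  have f: "0 < f" "f < real p" using assms by (auto simp: f_def)
  hence gap: "1 / f - 1 / real p > 0" by (simp add: frac_less2)
  hence \<delta>: "\<delta> > 0" "\<delta> \<le> \<epsilon>" "1 / real p + \<delta> < 1 / f"
  proof -
    have "\<delta> \<le> (1 / f - 1 / real p) / 2" unfolding \<delta>_def by (rule min.cobounded2)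
    thus "1 / real p + \<delta> < 1 / f" using gap by (simp add: field_simps)
  qed (use gap assms(2) in \<open>auto simp: \<delta>_def\<close>)
  obtain K where "(6 * ln (real p) + 18) / \<delta>\<^sup>2 \<le> real K" using real_arch_simple by blast
  hence K\<delta>: "6 * ln (real p) + 18 \<le> \<delta>\<^sup>2 * real K" using \<delta> by (simp add: field_simps)
  also have "\<dots> \<le> \<epsilon>\<^sup>2 * real K" using \<delta> by (intro mult_right_mono power_mono) auto
  finally have K\<epsilon>: "6 * ln (real p) + 18 \<le> \<epsilon>\<^sup>2 * real K" .
  have "ln (real p) \<ge> 0" using assms(1) by simp
  hence "K > 0" using K\<delta> by (cases "K = 0") auto
  define D where "D = 1632 * real K * real p ^ 4"
  have D: "D > 0" using \<open>K > 0\<close> assms(1) by (simp add: D_def)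
  have bound: "1 / sqrt D * sqrt (real n) \<le> real S" if "real n \<le> D * (real S)\<^sup>2" for n S
  proof -
    have "sqrt (real n) \<le> sqrt (D * (real S)\<^sup>2)" using that by simp
    thus ?thesis using D by (simp add: real_sqrt_mult field_simps)
  qed
  have linear: "distinguishes p n \<gamma> (linear_instances p n) A" if "distinguishes p n \<gamma> (ug_instances p n) A"
    for n \<gamma> A
    using that linear_instances_subset unfolding distinguishes_def by blast
  show ?thesis
  proof (intro exI[of _ "1 / sqrt D"] conjI allI impI)
    show "1 / sqrt D > 0" using D by simp
  next
    fix n S and A :: "real streaming_alg"
    assume "n \<ge> 2" "streaming_algorithm p n S borel A" "approximates_opt p n (real p - \<epsilon>) A"
    with approximates_opt_space_bound[OF assms(1) _ \<delta>(1) K\<delta> f(1) \<delta>(3)]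
    show "1 / sqrt D * sqrt (real n) \<le> real S" unfolding f_def D_def[symmetric] by (blast intro: bound)
  next
    fix n S and A :: "bool streaming_alg"
    assume "n \<ge> 2" "streaming_algorithm p n S (count_space UNIV) A"
      "distinguishes p n (1 / real p + \<epsilon>) (ug_instances p n) A"
    with distinguishes_space_bound[OF assms(1) _ assms(2) K\<epsilon>] linear
    show "1 / sqrt D * sqrt (real n) \<le> real S" unfolding D_def[symmetric] by (blast intro: bound)
  next
    fix n S and A :: "bool streaming_alg"
    assume "n \<ge> 2" "streaming_algorithm p n S (count_space UNIV) A"
      "distinguishes p n (1 / real p + \<epsilon>) (linear_instances p n) A"
    with distinguishes_space_bound[OF assms(1) _ assms(2) K\<epsilon>]
    show "1 / sqrt D * sqrt (real n) \<le> real S" unfolding D_def[symmetric] by (blast intro: bound)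
  qed
qed

end
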